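(* Let $X$ be a realcompact space. Then the space $C_k(X)$ is barrelled if and only if $C_k(X)$ is a Mackey group.
   Context: For a Tychonoff space $X$, $C_k(X)$ is the locally convex space of all continuous real-valued functions on $X$ endowed with the compact-open topology; realcompact spaces are Tychonoff. "Barrelled" refers to the locally convex space structure, and "Mackey group" refers to the underlying additive abelian topological group. Let $\mathbb{S}$ be the unit circle group and $\mathbb{S}_+=\{z\in\mathbb{S}:\ \mathrm{Re}(z)\ge 0\}$. For an abelian topological group $G$, $\widehat{G}$ is the group of all continuous characters, i.e. continuous homomorphisms $G\to\mathbb{S}$. $G$ is maximally almost periodic (MAP) if $\widehat{G}$ separates the points of $G$. A subset $A\subseteq G$ is quasi-convex if for every $g\in G\setminus A$ there is $\chi\in\widehat{G}$ with $\chi(g)\notin\mathbb{S}_+$ and $\chi(A)\subseteq\mathbb{S}_+$. $G$ is locally quasi-convex if it has a neighborhood base at $0$ consisting of quasi-convex sets; locally quasi-convex groups are understood to be MAP. Two group topologies $\tau,\nu$ on an abelian group $G$ are compatible if $\widehat{(G,\tau)}=\widehat{(G,\nu)}$. A locally quasi-convex abelian group $(G,\tau)$ is a Mackey group if every locally quasi-convex group topology $\nu$ on $G$ compatible with $\tau$ satisfies $\nu\le\tau$. *)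

theory Defs
  imports "HOL-Analysis.Analysis" "HOL-Algebra.Module"
begin

section \<open>Abelian topological groups and Mackey groups\<close>

text \<open>No separation axiom is built in here; for the groups of interest it follows from
  maximal almost periodicity.\<close>

locale abelian_topological_group = comm_group G for G (structure) +
  fixes T
  assumes topspace_eq_carrier: "topspace T = carrier G"
    and continuous_mult: "continuous_map (prod_topology T T) T (\<lambda>(x, y). x \<otimes> y)"
    and continuous_inv: "continuous_map T T (\<lambda>x. inv x)"

definition circle_group :: "complex monoid" where
  "circle_group = \<lparr>carrier = sphere 0 1, mult = (*), one = 1\<rparr>"

definition right_half_circle :: "complex set" where
  "right_half_circle = {z \<in> sphere 0 1. Re z \<ge> 0}"

text \<open>Characters are extensional, so that the character groups of two topologies on the same
  group can be compared as sets of functions.\<close>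

definition characters ::
  "('g, 'm) monoid_scheme \<Rightarrow> 'g topology \<Rightarrow> ('g \<Rightarrow> complex) set" where
  "characters G T = {\<phi> \<in> extensional (carrier G).
     \<phi> \<in> hom G circle_group \<and> continuous_map T (top_of_set (sphere 0 1)) \<phi>}"

definition maximally_almost_periodic :: "('g, 'm) monoid_scheme \<Rightarrow> 'g topology \<Rightarrow> bool" where
  "maximally_almost_periodic G T \<longleftrightarrow>
     (\<forall>x \<in> carrier G. \<forall>y \<in> carrier G. x \<noteq> y \<longrightarrow> (\<exists>\<phi> \<in> characters G T. \<phi> x \<noteq> \<phi> y))"

definition quasi_convex :: "('g, 'm) monoid_scheme \<Rightarrow> 'g topology \<Rightarrow> 'g set \<Rightarrow> bool" where
  "quasi_convex G T A \<longleftrightarrow> A \<subseteq> carrier G \<and>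
     (\<forall>g \<in> carrier G - A. \<exists>\<phi> \<in> characters G T.
        \<phi> g \<notin> right_half_circle \<and> \<phi> ` A \<subseteq> right_half_circle)"

definition locally_quasi_convex_group :: "('g, 'm) monoid_scheme \<Rightarrow> 'g topology \<Rightarrow> bool" where
  "locally_quasi_convex_group G T \<longleftrightarrow>
     abelian_topological_group G T \<and>
     maximally_almost_periodic G T \<and>
     neighbourhood_base_at \<one>\<^bsub>G\<^esub> (quasi_convex G T) T"

definition compatible_topologies ::
  "('g, 'm) monoid_scheme \<Rightarrow> 'g topology \<Rightarrow> 'g topology \<Rightarrow> bool" where
  "compatible_topologies G T S \<longleftrightarrow> characters G T = characters G S"

definition Mackey_group :: "('g, 'm) monoid_scheme \<Rightarrow> 'g topology \<Rightarrow> bool" where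
  "Mackey_group G T \<longleftrightarrow>
     locally_quasi_convex_group G T \<and>
     (\<forall>S. locally_quasi_convex_group G S \<and> compatible_topologies G T S \<longrightarrow>
        (\<forall>U. openin S U \<longrightarrow> openin T U))"


section \<open>Real locally convex spaces and barrelledness\<close>

definition real_scalars :: "real ring" where
  "real_scalars = \<lparr>carrier = UNIV, mult = (*), one = 1, zero = 0, add = (+)\<rparr>"

definition convex_in :: "(real, 'v, 'm) module_scheme \<Rightarrow> 'v set \<Rightarrow> bool" where
  "convex_in E A \<longleftrightarrow> A \<subseteq> carrier E \<and>
     (\<forall>x \<in> A. \<forall>y \<in> A. \<forall>t \<in> {0..1}. ((1 - t) \<odot>\<^bsub>E\<^esub> x) \<oplus>\<^bsub>E\<^esub> (t \<odot>\<^bsub>E\<^esub> y) \<in> A)"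

definition balanced_in :: "(real, 'v, 'm) module_scheme \<Rightarrow> 'v set \<Rightarrow> bool" where
  "balanced_in E A \<longleftrightarrow> A \<subseteq> carrier E \<and> (\<forall>x \<in> A. \<forall>t. \<bar>t\<bar> \<le> 1 \<longrightarrow> t \<odot>\<^bsub>E\<^esub> x \<in> A)"

definition absorbing_in :: "(real, 'v, 'm) module_scheme \<Rightarrow> 'v set \<Rightarrow> bool" where
  "absorbing_in E A \<longleftrightarrow> A \<subseteq> carrier E \<and>
     (\<forall>x \<in> carrier E. \<exists>r > 0. \<forall>t. \<bar>t\<bar> \<le> r \<longrightarrow> t \<odot>\<^bsub>E\<^esub> x \<in> A)"

locale locally_convex_space = Module.module real_scalars E for E (structure) +
  fixes T
  assumes topspace_eq_carrier: "topspace T = carrier E"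
    and continuous_add: "continuous_map (prod_topology T T) T (\<lambda>(x, y). x \<oplus> y)"
    and continuous_smult: "continuous_map (prod_topology euclideanreal T) T (\<lambda>(t, x). t \<odot> x)"
    and convex_base: "neighbourhood_base_at \<zero> (convex_in E) T"

definition barrel :: "(real, 'v, 'm) module_scheme \<Rightarrow> 'v topology \<Rightarrow> 'v set \<Rightarrow> bool" where
  "barrel E T B \<longleftrightarrow> closedin T B \<and> convex_in E B \<and> balanced_in E B \<and> absorbing_in E B"

definition barrelled_space :: "(real, 'v, 'm) module_scheme \<Rightarrow> 'v topology \<Rightarrow> bool" where
  "barrelled_space E T \<longleftrightarrow>
     locally_convex_space E T \<and>
     (\<forall>B. barrel E T B \<longrightarrow> (\<exists>U. openin T U \<and> \<zero>\<^bsub>E\<^esub> \<in> U \<and> U \<subseteq> B))"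


section \<open>The space $C_k(X)$\<close>

definition continuous_functions :: "'a topology \<Rightarrow> ('a \<Rightarrow> real) set" where
  "continuous_functions X = {f \<in> extensional (topspace X). continuous_map X euclideanreal f}"

text \<open>The record type of modules extends that of rings, whence the pointwise product
  and the unit.\<close>

definition function_space :: "'a topology \<Rightarrow> (real, 'a \<Rightarrow> real) module" where
  "function_space X =
     \<lparr>carrier = continuous_functions X,
      mult = (\<lambda>f g. \<lambda>x\<in>topspace X. f x * g x),
      one = (\<lambda>x\<in>topspace X. 1),
      zero = (\<lambda>x\<in>topspace X. 0),
      add = (\<lambda>f g. \<lambda>x\<in>topspace X. f x + g x),
      smult = (\<lambda>t f. \<lambda>x\<in>topspace X. t * f x)\<rparr>"

definition compact_open_topology :: "'a topology \<Rightarrow> ('a \<Rightarrow> real) topology" where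
  "compact_open_topology X = topology_generated_by
     {{f \<in> continuous_functions X. f ` K \<subseteq> V} | K V. compactin X K \<and> open V}"

lemma topspace_compact_open_topology:
  "topspace (compact_open_topology X) = continuous_functions X"
proof -
  have "continuous_functions X \<in>
      {{f \<in> continuous_functions X. f ` K \<subseteq> V} | K V. compactin X K \<and> open V}"
    by (rule CollectI, rule exI[of _ "{}"], rule exI[of _ UNIV]) auto
  then show ?thesis
    unfolding compact_open_topology_def topology_generated_by_topspace by blast
qed

lemma cring_real_scalars: "cring real_scalars"
proof (rule cringI)
  show "abelian_group real_scalars"
  proof (rule abelian_groupI)
    fix x assume "x \<in> carrier real_scalars"
    show "\<exists>y \<in> carrier real_scalars. y \<oplus>\<^bsub>real_scalars\<^esub> x = \<zero>\<^bsub>real_scalars\<^esub>"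
      by (rule bexI[of _ "- x"]) (auto simp: real_scalars_def)
  qed (auto simp: real_scalars_def)
  show "comm_monoid real_scalars"
    by (rule comm_monoidI) (auto simp: real_scalars_def)
qed (auto simp: real_scalars_def algebra_simps)

lemma restrict_in_continuous_functions:
  assumes "continuous_map X euclideanreal f"
  shows "restrict f (topspace X) \<in> continuous_functions X"
  using continuous_map_eq[OF assms, of "restrict f (topspace X)"]
  by (simp add: continuous_functions_def)

lemma module_function_space: "Module.module real_scalars (function_space X)"
proof -
  have cont: "continuous_map X euclideanreal f" if "f \<in> carrier (function_space X)" for f
    using that by (simp add: function_space_def continuous_functions_def)
  have undef: "f x = undefined" if "f \<in> carrier (function_space X)" "x \<notin> topspace X" for f x
    using that by (simp add: function_space_def continuous_functions_def extensional_def)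
  have carrier: "restrict f (topspace X) \<in> carrier (function_space X)"
    if "continuous_map X euclideanreal f" for f
    using restrict_in_continuous_functions[OF that] by (simp add: function_space_def)
  have zero: "\<zero>\<^bsub>function_space X\<^esub> = (\<lambda>x\<in>topspace X. 0)"
    and add: "\<And>f g. f \<oplus>\<^bsub>function_space X\<^esub> g = (\<lambda>x\<in>topspace X. f x + g x)"
    and smult: "\<And>t f. t \<odot>\<^bsub>function_space X\<^esub> f = (\<lambda>x\<in>topspace X. t * f x)"
    by (simp_all add: function_space_def)
  have scalars: "a \<oplus>\<^bsub>real_scalars\<^esub> b = a + b" "a \<otimes>\<^bsub>real_scalars\<^esub> b = a * b"
    "\<one>\<^bsub>real_scalars\<^esub> = 1" for a b
    by (simp_all add: real_scalars_def)
  have "abelian_group (function_space X)"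
  proof (rule abelian_groupI)
    fix f assume f: "f \<in> carrier (function_space X)"
    show "\<exists>g \<in> carrier (function_space X).
        g \<oplus>\<^bsub>function_space X\<^esub> f = \<zero>\<^bsub>function_space X\<^esub>"
    proof (rule bexI)
      show "(\<lambda>x\<in>topspace X. - f x) \<in> carrier (function_space X)"
        by (intro carrier continuous_map_minus cont f)
    qed (auto simp: add zero)
  next
    fix f g assume "f \<in> carrier (function_space X)" "g \<in> carrier (function_space X)"
    then show "f \<oplus>\<^bsub>function_space X\<^esub> g \<in> carrier (function_space X)"
      unfolding add by (intro carrier continuous_map_add cont)
  next
    show "\<zero>\<^bsub>function_space X\<^esub> \<in> carrier (function_space X)"
      unfolding zero by (intro carrier) simp
  qed (auto simp: add zero fun_eq_iff undef)
  moreover have "t \<odot>\<^bsub>function_space X\<^esub> f \<in> carrier (function_space X)"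
    if "f \<in> carrier (function_space X)" for t f
    unfolding smult using that by (intro carrier continuous_map_real_mult_left cont)
  ultimately show ?thesis
    by (intro moduleI[OF cring_real_scalars])
      (auto simp: add smult scalars fun_eq_iff undef algebra_simps)
qed


section \<open>Realcompact spaces\<close>

text \<open>A space is realcompact if it is homeomorphic to a closed subspace of a power of the real
  line. The exponent is taken to be a set of real functions on $X$; this is no restriction,
  since repeated coordinates can be dropped: see \<open>realcompact_spaceI\<close>, where the exponent
  has an arbitrary type.\<close>

definition realcompact_space :: "'a topology \<Rightarrow> bool" where
  "realcompact_space X \<longleftrightarrow>
     (\<exists>(I :: ('a \<Rightarrow> real) set) e. embedding_map X (powertop_real I) e \<and>
        closedin (powertop_real I) (e ` topspace X))"

lemma realcompact_spaceI:
  fixes I :: "'i set"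
  assumes emb: "embedding_map X (powertop_real I) e"
    and cl: "closedin (powertop_real I) (e ` topspace X)"
  shows "realcompact_space X"
proof -
  define c where "c i = (\<lambda>x. e x i)" for i
  define J where "J = c ` I"
  define d where "d x = (\<lambda>j\<in>J. j x)" for x
  define h where "h y = (\<lambda>i\<in>I. y (c i))" for y :: "('a \<Rightarrow> real) \<Rightarrow> real"
  have closed_e: "closed_map X (powertop_real I) e"
    using emb cl by (rule embedding_imp_closed_map)
  have cont_e: "continuous_map X (powertop_real I) e"
    using emb homeomorphic_imp_continuous_map continuous_map_in_subtopology
    unfolding embedding_map_def by blast
  have inj_e: "inj_on e (topspace X)"
    using emb homeomorphic_imp_injective_map unfolding embedding_map_def by blast
  have e_ext: "e x \<in> extensional I" if "x \<in> topspace X" for x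
    using cont_e that by (auto simp: continuous_map_componentwise)
  have hd: "h (d x) = e x" if "x \<in> topspace X" for x
    using e_ext[OF that] by (auto simp: h_def d_def J_def c_def extensional_def fun_eq_iff)
  have cont_d: "continuous_map X (powertop_real J) d"
    using cont_e by (auto simp: continuous_map_componentwise d_def J_def c_def)
  have cont_h: "continuous_map (powertop_real J) (powertop_real I) h"
    by (auto simp: continuous_map_componentwise h_def J_def
        intro!: continuous_map_product_projection)
  have inj_d: "inj_on d (topspace X)"
    using inj_e hd by (metis inj_on_def)
  have closed_d: "closed_map X (powertop_real J) d"
    unfolding closed_map_def
  proof (intro allI impI)
    fix C assume C: "closedin X C"
    have "d ` C = {y \<in> topspace (powertop_real J). h y \<in> e ` C}"
    proof (intro equalityI subsetI)
      fix y assume "y \<in> d ` C"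
      then show "y \<in> {y \<in> topspace (powertop_real J). h y \<in> e ` C}"
        using hd closedin_subset[OF C] by (auto simp: d_def)
    next
      fix y assume y: "y \<in> {y \<in> topspace (powertop_real J). h y \<in> e ` C}"
      then obtain x where x: "x \<in> C" "h y = e x" by auto
      have "y j = d x j" for j
      proof (cases "j \<in> J")
        case True
        then obtain i where i: "i \<in> I" "j = c i" by (auto simp: J_def)
        then show ?thesis
          using fun_cong[OF x(2), of i] True by (simp add: h_def d_def c_def)
      next
        case False
        then show ?thesis
          using y by (auto simp: d_def extensional_def PiE_def)
      qed
      then show "y \<in> d ` C"
        using x by blast
    qed
    moreover have "closedin (powertop_real I) (e ` C)"
      using closed_e C by (simp add: closed_map_def)
    ultimately show "closedin (powertop_real J) (d ` C)"
      using closedin_continuous_map_preimage[OF cont_h] by simp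
  qed
  have "embedding_map X (powertop_real J) d"
    using cont_d closed_d inj_d by (rule injective_closed_imp_embedding_map)
  moreover have "closedin (powertop_real J) (d ` topspace X)"
    using closed_d by (simp add: closed_map_def)
  ultimately show ?thesis
    unfolding realcompact_space_def by blast
qed

lemma realcompact_space_imp_Tychonoff:
  assumes "realcompact_space X"
  shows "completely_regular_space X \<and> Hausdorff_space X"
proof -
  obtain I :: "('a \<Rightarrow> real) set" and e where emb: "embedding_map X (powertop_real I) e"
    using assms unfolding realcompact_space_def by blast
  have "X homeomorphic_space subtopology (powertop_real I) (e ` topspace X)"
    using emb by (rule embedding_map_imp_homeomorphic_space)
  moreover have "completely_regular_space (powertop_real I)"
    by (simp add: completely_regular_space_product_topology
        metrizable_imp_completely_regular_space metrizable_space_euclidean)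
  moreover have "Hausdorff_space (powertop_real I)"
    by (simp add: Hausdorff_space_product_topology)
  ultimately show ?thesis
    using homeomorphic_completely_regular_space homeomorphic_Hausdorff_space
      completely_regular_space_subtopology Hausdorff_space_subtopology by blast
qed

end

theory Submission
  imports Defs
begin

text \<open>For a realcompact space \<open>X\<close> both sides of the equivalence hold.

  That $C_k(X)$ is barrelled is the theorem of Nachbin and Shirota. Let \<open>B\<close> be a barrel. By a
  category argument \<open>B\<close> absorbs every order interval \<open>{f. \<bar>f\<bar> \<le> h}\<close> with \<open>h\<close> continuous
  (\<open>order_interval_absorbed\<close>). Applied to the order interval of a locally finite sum, this shows
  that functions supported further and further out eventually lie in \<open>B\<close>: for each continuous
  \<open>\<phi>\<close> there is a bound \<open>M\<close> such that \<open>B\<close> contains all functions that vanish where \<open>\<phi> \<le> M\<close> (\<open>supported_far_out_imp_mem\<close>). For the coordinates of a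
  closed embedding of \<open>X\<close> into a power of the real line these bounds cut out a set \<open>K\<close>, which is
  compact by Tychonoff's theorem. A partition of unity on compact sets, together with the closedness
  of \<open>B\<close>, shows that \<open>B\<close> contains every function vanishing on a neighbourhood of \<open>K\<close>
  (\<open>support_in_intersection\<close>). Truncation splits a function that is small on \<open>K\<close> into such a
  function and a uniformly small one, so \<open>B\<close> is a neighbourhood of zero.

  That a barrelled space is a Mackey group rests on two facts about characters of a locally convex
  space. Firstly, a continuous character is \<open>x \<mapsto> cis (p x)\<close> for a linear functional \<open>p\<close>, its
  \<open>phase\<close>. Secondly, let \<open>S\<close> be a group topology with the same characters and \<open>U\<close> a neighbourhood
  of zero in it. The characters that map \<open>U\<close> into the right half of the circle form a pointwise
  compact set \<open>P\<close> (\<open>compact_polar\<close>): a homomorphism that maps a neighbourhood of the identity into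
  the half circle is continuous. On a fixed line the set \<open>P\<close> becomes a set of characters of the
  reals that is compact for pointwise convergence, and by a theorem of Glicksberg, here proved by
  dominated convergence, the frequencies are bounded (\<open>bounded_if_characters_compact\<close>). Hence the
  phases of the members of \<open>P\<close> are pointwise bounded and their common polar is a barrel, which lies
  in \<open>U\<close> when \<open>U\<close> is quasi-convex. In a barrelled space \<open>U\<close> is then a neighbourhood of zero for the
  original topology.\<close>

section \<open>Characters of the real line\<close>

text \<open>Additivity and \<open>j 1 = 0\<close> make \<open>j\<close> periodic with period one, hence bounded by its
  maximum on the unit interval, and a bounded additive function vanishes.\<close>

lemma additive_periodic_continuous_eq_0:
  fixes j :: "real \<Rightarrow> real"
  assumes cont: "continuous_on UNIV j"
    and add: "\<And>s t. j (s + t) = j s + j t"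
    and one: "j 1 = 0"
  shows "j t = 0"
proof -
  have j0: "j 0 = 0"
    using add[of 0 0] by simp
  have mult: "j (real n * t) = real n * j t" for n t
    by (induction n) (simp_all add: j0 add algebra_simps)
  have neg: "j (- t) = - j t" for t
    using add[of t "- t"] j0 by simp
  have int0: "j (of_int m) = 0" for m
  proof (cases m)
    case (nonneg n)
    then show ?thesis using mult[of n 1] one by simp
  next
    case (neg n)
    then show ?thesis using mult[of "Suc n" 1] one \<open>\<And>t. j (- t) = - j t\<close>
      by (metis mult.right_neutral mult_zero_right neg_equal_0_iff_equal of_int_minus of_int_of_nat_eq)
  qed
  have "bounded (j ` {0..1})"
    using cont by (intro compact_imp_bounded compact_continuous_image)
      (auto intro: continuous_on_subset)
  then obtain C where C: "\<forall>t \<in> {0..1}. \<bar>j t\<bar> \<le> C"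
    by (auto simp: bounded_iff)
  have bound: "\<bar>j t\<bar> \<le> C" for t
  proof -
    have "j t = j (of_int \<lfloor>t\<rfloor> + frac t)"
      by (simp add: frac_def)
    also have "\<dots> = j (frac t)"
      by (simp add: add int0)
    finally show ?thesis
      using bspec[OF C, of "frac t"] frac_ge_0[of t] frac_lt_1[of t] by (simp add: less_imp_le)
  qed
  show ?thesis
  proof (rule ccontr)
    assume nz: "j t \<noteq> 0"
    then obtain n where "C < real n * \<bar>j t\<bar>"
      using reals_Archimedean3[of "\<bar>j t\<bar>"] by auto
    with bound[of "real n * t"] show False
      by (simp add: mult abs_mult)
  qed
qed

lemma cis_eq_iff_int: "cis a = cis b \<longleftrightarrow> (\<exists>m::int. a = b + 2 * pi * of_int m)"
proof -
  have "cis a = cis b \<longleftrightarrow> sin a = sin b \<and> cos a = cos b"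
    by (auto simp: complex_eq_iff)
  then show ?thesis
    using sin_cos_eq_iff[of a b] by (simp add: mult.commute mult.left_commute)
qed

text \<open>Lifting \<open>\<phi>\<close> along the covering \<^term>\<open>cis\<close> gives a continuous function that is additive
  up to an integer multiple of $2\pi$; by connectedness that multiple is constant.\<close>

lemma one_parameter_subgroup_of_circle:
  fixes \<phi> :: "real \<Rightarrow> complex"
  assumes cont: "continuous_on UNIV \<phi>"
    and mult: "\<And>s t. \<phi> (s + t) = \<phi> s * \<phi> t"
    and norm: "\<And>t. norm (\<phi> t) = 1"
  obtains c where "\<And>t. \<phi> t = cis (c * t)"
proof -
  have nz: "\<phi> t \<noteq> 0" for t
    using norm[of t] by auto
  obtain g where g: "continuous_on UNIV g" "\<And>t. \<phi> t = exp (g t)"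
    using continuous_logarithm_on_contractible[OF cont] nz
    by (metis UNIV_I convex_UNIV convex_imp_contractible)
  define h where "h t = Im (g t)" for t
  have "Re (g t) = 0" for t
    using norm[of t] by (simp add: g(2))
  then have phi: "\<phi> t = cis (h t)" for t
    by (simp add: g(2) h_def exp_eq_polar)
  have h: "continuous_on UNIV h"
    unfolding h_def by (intro continuous_intros g)
  have "\<phi> 0 = 1"
    using mult[of 0 0] nz[of 0] by simp
  have step: "h (s + t) = h s + h t - h 0" for s t
  proof -
    define d where "d s = h (s + t) - h s - h t" for s
    have d: "\<exists>m::int. d s = 2 * pi * of_int m" for s
    proof -
      have "cis (h (s + t)) = cis (h s + h t)"
        using mult[of s t] by (simp add: phi cis_mult)
      then show ?thesis
        unfolding cis_eq_iff_int d_def by (auto simp: algebra_simps)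
    qed
    have "d constant_on UNIV"
    proof (rule continuous_discrete_range_constant)
      show "continuous_on UNIV d"
        unfolding d_def by (intro continuous_intros continuous_on_compose2[OF h]) auto
      fix x :: real
      show "\<exists>e>0. \<forall>y. y \<in> UNIV \<and> d y \<noteq> d x \<longrightarrow> e \<le> norm (d y - d x)"
      proof (intro exI[of _ "2 * pi"] conjI allI impI)
        fix y assume y: "y \<in> UNIV \<and> d y \<noteq> d x"
        obtain m n :: int where mn: "d x = 2 * pi * of_int m" "d y = 2 * pi * of_int n"
          using d by metis
        with y have "m \<noteq> n" by auto
        then have "1 \<le> \<bar>of_int (n - m) :: real\<bar>"
          by linarith
        then have "2 * pi * 1 \<le> 2 * pi * \<bar>of_int (n - m) :: real\<bar>"
          by (intro mult_left_mono) auto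
        also have "\<dots> = norm (d y - d x)"
          by (simp add: mn abs_mult right_diff_distrib flip: right_diff_distrib)
        finally show "2 * pi \<le> norm (d y - d x)" by simp
      qed simp
    qed auto
    then have "d s = d 0"
      by (auto simp: constant_on_def)
    then show ?thesis by (simp add: d_def)
  qed
  \<comment> \<open>The deviation of \<open>h\<close> from the affine function through its values at zero and one.\<close>
  define j where "j t = (h t - h 0) - t * (h 1 - h 0)" for t
  have "j t = 0" for t
  proof (rule additive_periodic_continuous_eq_0[of j])
    show "continuous_on UNIV j"
      unfolding j_def by (intro continuous_intros h)
  qed (simp_all add: j_def step algebra_simps)
  then have linear: "h t = h 0 + (h 1 - h 0) * t" for t
    by (simp add: j_def algebra_simps)
  have "\<phi> t = cis (h 0) * cis ((h 1 - h 0) * t)" for t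
    unfolding phi[of t] cis_mult using linear[of t] by (rule arg_cong)
  moreover have "cis (h 0) = 1"
    using \<open>\<phi> 0 = 1\<close> by (simp add: phi)
  ultimately show thesis
    using that by simp
qed

lemma cis_line_eq_imp_eq:
  assumes "\<And>t. cis (a * t) = cis (b * t)"
  shows "a = b"
proof (rule ccontr)
  assume "a \<noteq> b"
  have "cis ((a - b) * t) = 1" for t
  proof -
    have "cis ((a - b) * t) = cis (a * t) / cis (b * t)"
      by (simp add: cis_divide algebra_simps)
    then show ?thesis using assms[of t] by simp
  qed
  from this[of "pi / (a - b)"] show False
    using \<open>a \<noteq> b\<close> by simp
qed

lemma ex_irrational: "\<exists>\<alpha>::real. \<alpha> \<notin> \<rat>"
  using countable_rat uncountable_UNIV_real by (metis UNIV_eq_I)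

text \<open>The closed subgroup generated by two incommensurable reals is the whole line, so the values
  at two such points determine a character; this is what makes a pointwise compact set of characters
  sequentially compact below.\<close>

lemma cis_eq_at_irrational_imp_eq:
  assumes "\<alpha> \<notin> \<rat>" "cis a = cis b" "cis (a * \<alpha>) = cis (b * \<alpha>)"
  shows "a = b"
proof (rule ccontr)
  assume ne: "a \<noteq> b"
  obtain m n :: int where m: "a = b + 2 * pi * of_int m" and n: "a * \<alpha> = b * \<alpha> + 2 * pi * of_int n"
    using assms unfolding cis_eq_iff_int by auto
  have "m \<noteq> 0" using m ne by auto
  have "2 * pi * (of_int m * \<alpha>) = 2 * pi * of_int n"
    using n unfolding m by (simp add: algebra_simps)
  then have "of_int m * \<alpha> = of_int n" by simp
  then have "\<alpha> = of_int n / of_int m"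
    using \<open>m \<noteq> 0\<close> by (simp add: field_simps)
  then show False using assms(1) by (auto simp: Rats_divide)
qed

text \<open>A function with compact graph is continuous.\<close>

lemma compact_graph_imp_convergent:
  fixes Q :: "('a::metric_space \<times> 'b::metric_space) set"
  assumes Q: "compact Q"
    and graph: "\<And>a b b'. (a, b) \<in> Q \<Longrightarrow> (a, b') \<in> Q \<Longrightarrow> b = b'"
    and ab: "(a, b) \<in> Q"
    and X: "\<And>n. (u n, v n) \<in> Q" "u \<longlonglongrightarrow> a"
  shows "v \<longlonglongrightarrow> b"
proof (rule ccontr)
  assume "\<not> v \<longlonglongrightarrow> b"
  then obtain e where e: "e > 0" "\<not> (\<forall>\<^sub>F n in sequentially. dist (v n) b < e)"
    unfolding tendsto_iff by auto
  then have "infinite {n. \<not> dist (v n) b < e}"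
    by (simp flip: cofinite_eq_sequentially add: eventually_cofinite)
  then obtain r :: "nat \<Rightarrow> nat" where "strict_mono r" "\<forall>n. r n \<in> {n. \<not> dist (v n) b < e}"
    using infinite_enumerate by blast
  then have r: "strict_mono r" "\<And>n. \<not> dist (v (r n)) b < e"
    by auto
  have "\<forall>n. (u (r n), v (r n)) \<in> Q" using X by auto
  then obtain l s where l: "l \<in> Q" "strict_mono (s :: nat \<Rightarrow> nat)"
      "((\<lambda>n. (u (r n), v (r n))) \<circ> s) \<longlonglongrightarrow> l"
    using seq_compactE[OF compact_imp_seq_compact[OF Q], of "\<lambda>n. (u (r n), v (r n))"] by blast
  obtain a' b' where l': "l = (a', b')" by force
  have 1: "(\<lambda>n. u (r (s n))) \<longlonglongrightarrow> a'" and 2: "(\<lambda>n. v (r (s n))) \<longlonglongrightarrow> b'"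
    using tendsto_fst[OF l(3)] tendsto_snd[OF l(3)] by (simp_all add: l' o_def)
  have "(\<lambda>n. u (r (s n))) \<longlonglongrightarrow> a"
    using LIMSEQ_subseq_LIMSEQ[OF X(2) strict_mono_o[OF r(1) l(2)]] by (simp add: o_def)
  then have "a' = a" using 1 LIMSEQ_unique by blast
  then have "b' = b" using l l' ab graph by blast
  then have "\<forall>\<^sub>F n in sequentially. dist (v (r (s n))) b < e"
    using 2 e(1) by (auto simp: tendsto_iff)
  then show False using r(2) by simp
qed

lemma integral_cis:
  assumes "c \<noteq> 0"
  shows "((\<lambda>t. cis (c * t)) has_integral (cis c - 1) / (\<i> * c)) {0..1}"
proof -
  have "((\<lambda>t. cis (c * t)) has_integral cis (c * 1) / (\<i> * c) - cis (c * 0) / (\<i> * c)) {0..1}"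
  proof (rule fundamental_theorem_of_calculus)
    fix t :: real
    show "((\<lambda>t. cis (c * t) / (\<i> * c)) has_vector_derivative cis (c * t)) (at t within {0..1})"
      unfolding has_vector_derivative_complex_iff using assms
      by (auto intro!: derivative_eq_intros simp: complex_eq_iff Re_divide Im_divide field_simps power2_eq_square)
  qed simp
  then show ?thesis by (simp add: diff_divide_distrib)
qed

text \<open>A sequence in \<open>S\<close> has a subsequence along which the characters converge at \<open>1\<close> and at an
  irrational \<open>\<alpha>\<close>. By compactness the values at these two points determine the values everywhere
  continuously, so the characters converge pointwise to a member of the family. If the frequencies
  tended to infinity, the integrals of the quotients over the unit interval would tend to \<open>0\<close> by
  explicit computation and to \<open>1\<close> by dominated convergence.\<close>

lemma bounded_if_characters_compact:
  fixes S :: "real set"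
  assumes cpt: "compact ((\<lambda>s t. cis (s * t)) ` S)"
  shows "bounded S"
proof (rule ccontr)
  assume "\<not> bounded S"
  then have "\<forall>n::nat. \<exists>s\<in>S. real n < \<bar>s\<bar>"
    unfolding bounded_iff by (auto simp: not_le)
  then obtain s where s: "\<And>n. s n \<in> S" "\<And>n. real n < \<bar>s n\<bar>"
    by metis
  obtain \<alpha> :: real where \<alpha>: "\<alpha> \<notin> \<rat>"
    using ex_irrational by blast
  define Q where "Q t = (\<lambda>c. ((cis c, cis (c * \<alpha>)), cis (c * t))) ` S" for t
  have Q: "compact (Q t)" for t
  proof -
    have "compact ((\<lambda>g. ((g 1, g \<alpha>), g t)) ` (\<lambda>s t. cis (s * t)) ` S)"
      by (intro compact_continuous_image[OF _ cpt] continuous_on_Pair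
          continuous_on_subset[OF continuous_on_product_coordinates subset_UNIV])
    then show ?thesis by (simp add: Q_def image_image)
  qed
  \<comment> \<open>The third component of \<^term>\<open>Q 0\<close> is constant, so convergence in it is convergence at \<open>1\<close> and \<open>\<alpha>\<close>.\<close>
  have "\<forall>n. ((cis (s n), cis (s n * \<alpha>)), cis (s n * 0)) \<in> Q 0"
    using s by (auto simp: Q_def)
  then obtain l r where l: "l \<in> Q 0" "strict_mono (r :: nat \<Rightarrow> nat)"
      "((\<lambda>n. ((cis (s n), cis (s n * \<alpha>)), cis (s n * 0))) \<circ> r) \<longlonglongrightarrow> l"
    using seq_compactE[OF compact_imp_seq_compact[OF Q[of 0]],
        of "\<lambda>n. ((cis (s n), cis (s n * \<alpha>)), cis (s n * 0))"] by blast
  then obtain c where c: "c \<in> S" "l = ((cis c, cis (c * \<alpha>)), cis (c * 0))"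
    by (auto simp: Q_def)
  have u: "(\<lambda>n. (cis (s (r n)), cis (s (r n) * \<alpha>))) \<longlonglongrightarrow> (cis c, cis (c * \<alpha>))"
    using tendsto_fst[OF l(3)] by (simp add: c o_def)
  have conv: "(\<lambda>n. cis (s (r n) * t)) \<longlonglongrightarrow> cis (c * t)" for t
    by (rule compact_graph_imp_convergent[OF Q[of t] _ _ _ u])
      (use s c cis_eq_at_irrational_imp_eq[OF \<alpha>] in \<open>auto simp: Q_def\<close>)
  define d where "d n = s (r n) - c" for n
  have conv1: "(\<lambda>n. cis (d n * t)) \<longlonglongrightarrow> 1" for t
  proof -
    have "(\<lambda>n. cis (s (r n) * t) / cis (c * t)) \<longlonglongrightarrow> cis (c * t) / cis (c * t)"
      by (intro tendsto_divide conv tendsto_const) simp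
    then show ?thesis by (simp add: d_def cis_divide algebra_simps)
  qed
  have "(\<lambda>n. integral {0..1::real} (\<lambda>t. cis (d n * t))) \<longlonglongrightarrow> integral {0..1::real} (\<lambda>t. 1)"
    by (rule dominated_convergence[where h = "\<lambda>_. 1"])
      (auto intro!: integrable_continuous_real continuous_intros conv1)
  then have lim1: "(\<lambda>n. integral {0..1::real} (\<lambda>t. cis (d n * t))) \<longlonglongrightarrow> 1"
    by simp
  have dinf: "filterlim (\<lambda>n. \<bar>d n\<bar>) at_top sequentially"
  proof (rule filterlim_at_top_mono)
    show "filterlim (\<lambda>n. real n - \<bar>c\<bar>) at_top sequentially"
      using filterlim_tendsto_add_at_top[OF tendsto_const[of "- \<bar>c\<bar>"] filterlim_real_sequentially]
      by simp
    show "\<forall>\<^sub>F n in sequentially. real n - \<bar>c\<bar> \<le> \<bar>d n\<bar>"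
    proof (rule always_eventually, rule allI)
      fix n
      have "real n \<le> real (r n)" using l(2) by (simp add: strict_mono_imp_increasing)
      then show "real n - \<bar>c\<bar> \<le> \<bar>d n\<bar>"
        using s(2)[of "r n"] unfolding d_def by linarith
    qed
  qed
  have "(\<lambda>n. 2 / \<bar>d n\<bar>) \<longlonglongrightarrow> 0"
    by (rule tendsto_divide_0[OF tendsto_const filterlim_at_top_imp_at_infinity[OF dinf]])
  moreover have "\<forall>\<^sub>F n in sequentially.
      norm (integral {0..1::real} (\<lambda>t. cis (d n * t))) \<le> 2 / \<bar>d n\<bar>"
    using filterlim_at_top_dense[THEN iffD1, OF dinf, rule_format, of 0]
  proof eventually_elim
    case (elim n)
    then have "integral {0..1} (\<lambda>t. cis (d n * t)) = (cis (d n) - 1) / (\<i> * d n)"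
      by (intro integral_unique integral_cis) auto
    moreover have "norm (cis (d n) - 1) \<le> 2"
      using norm_triangle_ineq4[of "cis (d n)" 1] by simp
    ultimately show ?case
      by (simp add: norm_divide norm_mult divide_right_mono)
  qed
  ultimately have "(\<lambda>n. integral {0..1::real} (\<lambda>t. cis (d n * t))) \<longlonglongrightarrow> 0"
    by (rule Lim_null_comparison[rotated])
  with lim1 show False
    using LIMSEQ_unique by fastforce
qed

section \<open>Polars in abelian topological groups\<close>

lemma continuous_map_into_euclidean_metric:
  fixes f :: "'a \<Rightarrow> 'b::metric_space"
  shows "continuous_map X euclidean f \<longleftrightarrow>
    (\<forall>x\<in>topspace X. \<forall>e>0. \<exists>U. openin X U \<and> x \<in> U \<and> (\<forall>y\<in>U. dist (f x) (f y) < e))"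
  using Met_TC.continuous_map_to_metric[of X f] by (simp add: Met_TC.in_mball)

lemma circle_group_simps [simp]:
  "carrier circle_group = sphere 0 1" "x \<otimes>\<^bsub>circle_group\<^esub> y = x * y" "\<one>\<^bsub>circle_group\<^esub> = 1"
  by (simp_all add: circle_group_def)

lemma real_scalars_simps [simp]:
  "carrier real_scalars = UNIV" "x \<otimes>\<^bsub>real_scalars\<^esub> y = x * y" "\<one>\<^bsub>real_scalars\<^esub> = 1"
  "x \<oplus>\<^bsub>real_scalars\<^esub> y = x + y" "\<zero>\<^bsub>real_scalars\<^esub> = 0"
  by (simp_all add: real_scalars_def)

text \<open>On the right half of the unit circle, doubling the angle at least doubles the distance
  \<open>1 - Re z\<close> from the identity, because \<open>1 - Re (z\<^sup>2) = 2 (1 - Re z) (1 + Re z)\<close>.\<close>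

lemma sphere_doubling_Re:
  assumes "z \<in> sphere 0 1" "Re z \<ge> 0" "Re (z * z) \<ge> 1 - 2 * d"
  shows "Re z \<ge> 1 - d"
proof -
  have sq: "(Re z)\<^sup>2 + (Im z)\<^sup>2 = 1"
    using assms(1) by (simp add: cmod_def)
  then have le1: "Re z \<le> 1"
    using complex_Re_le_cmod[of z] assms(1) by simp
  have "2 * (1 - Re z) \<le> 2 * ((1 - Re z) * (1 + Re z))"
    using assms(2) le1 by (intro mult_left_mono) (auto simp: mult_le_cancel_left1)
  also have "\<dots> = 1 - Re (z * z)"
    using sq by (simp add: algebra_simps power2_eq_square)
  also have "\<dots> \<le> 2 * d"
    using assms(3) by simp
  finally show ?thesis by simp
qed

lemma dist_1_sphere:
  assumes "z \<in> sphere 0 1"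
  shows "(dist 1 z)\<^sup>2 = 2 * (1 - Re z)"
proof -
  have "(Re z)\<^sup>2 + (Im z)\<^sup>2 = 1"
    using assms by (simp add: cmod_def)
  then show ?thesis
    by (simp only: dist_norm cmod_power2 minus_complex.simps one_complex.simps)
      (simp add: power2_eq_square algebra_simps)
qed

context abelian_topological_group
begin

lemma continuous_translation:
  assumes "a \<in> carrier G"
  shows "continuous_map T T (\<lambda>x. a \<otimes> x)"
proof -
  have "continuous_map T (prod_topology T T) (\<lambda>x. (a, x))"
    using assms by (intro continuous_intros) (simp_all add: topspace_eq_carrier)
  from continuous_map_compose[OF this continuous_mult] show ?thesis
    by (simp add: o_def)
qed

lemma openin_translation:
  assumes "a \<in> carrier G" "openin T V"
  shows "openin T {x \<in> carrier G. a \<otimes> x \<in> V}"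
  using openin_continuous_map_preimage[OF continuous_translation assms(2)] assms(1)
  by (simp add: topspace_eq_carrier)

lemma continuous_square: "continuous_map T T (\<lambda>x. x \<otimes> x)"
proof -
  have "continuous_map T (prod_topology T T) (\<lambda>x. (x, x))"
    by (intro continuous_intros)
  from continuous_map_compose[OF this continuous_mult] show ?thesis
    by (simp add: o_def)
qed

text \<open>Shrinking the neighbourhood until it can be doubled \<open>n\<close> times inside \<open>U\<close> forces the values of
  the homomorphism towards \<open>1\<close>, since the right half circle contains no nontrivial subgroup.\<close>

lemma hom_right_half_imp_near_1:
  assumes hom: "\<phi> \<in> hom G circle_group"
    and U: "openin T U" "\<one> \<in> U" "\<phi> ` U \<subseteq> right_half_circle"
  shows "\<exists>V. openin T V \<and> \<one> \<in> V \<and> V \<subseteq> U \<and> (\<forall>x\<in>V. Re (\<phi> x) \<ge> 1 - 1 / 2 ^ n)"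
proof (induction n)
  case 0
  show ?case using U by (intro exI[of _ U]) (auto simp: right_half_circle_def)
next
  case (Suc n)
  then obtain V where V: "openin T V" "\<one> \<in> V" "V \<subseteq> U" "\<And>x. x \<in> V \<Longrightarrow> Re (\<phi> x) \<ge> 1 - 1 / 2 ^ n"
    by blast
  define W where "W = V \<inter> {x \<in> carrier G. x \<otimes> x \<in> V}"
  have "openin T W"
    using openin_continuous_map_preimage[OF continuous_square V(1)] V(1)
    by (auto simp: W_def topspace_eq_carrier)
  moreover have "Re (\<phi> x) \<ge> 1 - 1 / 2 ^ Suc n" if "x \<in> W" for x
  proof (rule sphere_doubling_Re)
    have x: "x \<in> carrier G" "x \<in> V" "x \<otimes> x \<in> V" using that by (auto simp: W_def)
    show "\<phi> x \<in> sphere 0 1" "Re (\<phi> x) \<ge> 0"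
      using x V(3) U(3) by (auto simp: right_half_circle_def)
    show "Re (\<phi> x * \<phi> x) \<ge> 1 - 2 * (1 / 2 ^ Suc n)"
      using V(4)[OF x(3)] hom_mult[OF hom x(1) x(1)] by simp
  qed
  moreover have "\<one> \<in> W" "W \<subseteq> U" using V by (auto simp: W_def)
  ultimately show ?case by blast
qed

text \<open>By homogeneity it suffices to control the values near the identity, where
  \<open>\<bar>1 - z\<bar>\<^sup>2 = 2 (1 - Re z)\<close> turns the bound on the real part into a bound on the distance.\<close>

lemma hom_continuous_if_right_half:
  assumes hom: "\<phi> \<in> hom G circle_group"
    and U: "openin T U" "\<one> \<in> U" "\<phi> ` U \<subseteq> right_half_circle"
  shows "continuous_map T (top_of_set (sphere 0 1)) \<phi>"
proof -
  have sphere: "norm (\<phi> x) = 1" if "x \<in> carrier G" for x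
    using hom_in_carrier[OF hom that] by simp
  have "continuous_map T euclidean \<phi>"
    unfolding continuous_map_into_euclidean_metric
  proof (intro ballI allI impI)
    fix x and e :: real assume x: "x \<in> topspace T" and e: "e > 0"
    then have xG: "x \<in> carrier G" by (simp add: topspace_eq_carrier)
    obtain n where n: "(1/2) ^ n < e\<^sup>2 / 2"
      using real_arch_pow_inv[of "e\<^sup>2 / 2" "1/2"] e by auto
    obtain V where V: "openin T V" "\<one> \<in> V" "\<And>y. y \<in> V \<Longrightarrow> Re (\<phi> y) \<ge> 1 - 1 / 2 ^ n"
      using hom_right_half_imp_near_1[OF hom U] by meson
    have "dist (\<phi> x) (\<phi> y) < e" if y: "y \<in> carrier G" "inv x \<otimes> y \<in> V" for y
    proof -
      have "\<phi> y = \<phi> (x \<otimes> (inv x \<otimes> y))"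
        using xG y(1) by (simp add: m_assoc[symmetric])
      also have "\<dots> = \<phi> x * \<phi> (inv x \<otimes> y)"
        using hom_mult[OF hom xG, of "inv x \<otimes> y"] xG y by simp
      finally have "\<phi> x - \<phi> y = \<phi> x * (1 - \<phi> (inv x \<otimes> y))"
        by (simp add: algebra_simps)
      then have "dist (\<phi> x) (\<phi> y) = dist 1 (\<phi> (inv x \<otimes> y))"
        using sphere[OF xG] by (simp add: dist_norm norm_mult)
      moreover have "(dist 1 (\<phi> (inv x \<otimes> y)))\<^sup>2 = 2 * (1 - Re (\<phi> (inv x \<otimes> y)))"
        using xG y by (intro dist_1_sphere) (simp add: sphere)
      moreover have "\<dots> \<le> 2 * (1 / 2 ^ n)"
        using V(3)[OF y(2)] by simp
      moreover have "\<dots> < e\<^sup>2"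
        using n by (simp add: power_divide)
      ultimately have "(dist (\<phi> x) (\<phi> y))\<^sup>2 < e\<^sup>2" by simp
      then show ?thesis
        using e by (simp add: power_less_imp_less_base)
    qed
    moreover have "openin T {y \<in> carrier G. inv x \<otimes> y \<in> V}"
      using xG V by (intro openin_translation) auto
    ultimately show "\<exists>U. openin T U \<and> x \<in> U \<and> (\<forall>y\<in>U. dist (\<phi> x) (\<phi> y) < e)"
      using xG V(2) by (intro exI[of _ "{y \<in> carrier G. inv x \<otimes> y \<in> V}"]) auto
  qed
  then show ?thesis
    using sphere by (auto simp: continuous_map_in_subtopology topspace_eq_carrier)
qed

definition polar :: "'a set \<Rightarrow> ('a \<Rightarrow> complex) set" where
  "polar U = {\<phi> \<in> characters G T. \<phi> ` U \<subseteq> right_half_circle}"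

text \<open>The polar is cut out of a power of the circle by closed conditions, namely multiplicativity and
  the position of the values on \<open>U\<close>; continuity comes for free from
  \<open>hom_continuous_if_right_half\<close>.\<close>

lemma compact_polar:
  assumes V: "openin T V" "\<one> \<in> V" "V \<subseteq> U" and U: "U \<subseteq> carrier G"
  shows "compactin (product_topology (\<lambda>_. euclidean) (carrier G)) (polar U)"
proof -
  define Y where "Y = product_topology (\<lambda>_. euclidean :: complex topology) (carrier G)"
  define K where "K = (carrier G \<rightarrow>\<^sub>E sphere (0::complex) 1)"
  have proj: "continuous_map Y euclidean (\<lambda>\<phi>. \<phi> x)" if "x \<in> carrier G" for x
    using that unfolding Y_def by (rule continuous_map_product_projection)
  have top: "topspace Y = extensional (carrier G)"
    by (auto simp: Y_def PiE_def)
  have K: "compactin Y K"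
    unfolding Y_def K_def by (simp add: compactin_PiE)
  have clK: "closedin Y K"
    using K by (rule compactin_imp_closedin[rotated])
      (simp add: Y_def Hausdorff_space_product_topology)
  have mult: "continuous_map Y euclidean (\<lambda>\<phi>. f \<phi> * g \<phi>)"
    if "continuous_map Y euclidean f" "continuous_map Y euclidean g"
    for f g :: "('a \<Rightarrow> complex) \<Rightarrow> complex"
    using that unfolding continuous_map_atin by (auto intro: tendsto_mult)
  have eq: "closedin Y {\<phi> \<in> topspace Y. \<phi> (x \<otimes> y) = \<phi> x * \<phi> y}"
    if "x \<in> carrier G" "y \<in> carrier G" for x y
  proof -
    have "continuous_map Y euclidean (\<lambda>\<phi>. \<phi> (x \<otimes> y) - \<phi> x * \<phi> y)"
      using that by (intro continuous_map_diff mult proj) auto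
    from closedin_continuous_map_preimage[OF this, of "{0}"] show ?thesis
      by simp
  qed
  have re: "closedin Y {\<phi> \<in> topspace Y. Re (\<phi> x) \<ge> 0}" if "x \<in> carrier G" for x
  proof -
    have "closed {z. Re z \<ge> 0}" by (rule closed_halfspace_Re_ge)
    then show ?thesis
      using closedin_continuous_map_preimage[OF proj[OF that], of "{z. Re z \<ge> 0}"] by simp
  qed
  have "polar U = K \<inter> (\<Inter>x\<in>carrier G. \<Inter>y\<in>carrier G. {\<phi> \<in> topspace Y. \<phi> (x \<otimes> y) = \<phi> x * \<phi> y})
      \<inter> (topspace Y \<inter> (\<Inter>x\<in>U. {\<phi> \<in> topspace Y. Re (\<phi> x) \<ge> 0}))" (is "_ = ?R")
  proof (intro equalityI subsetI)
    fix \<phi> assume "\<phi> \<in> polar U"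
    then have "\<phi> \<in> extensional (carrier G)" "\<phi> \<in> hom G circle_group" "\<phi> ` U \<subseteq> right_half_circle"
      by (auto simp: polar_def characters_def)
    then show "\<phi> \<in> ?R"
      unfolding top K_def using U by (auto simp: hom_def right_half_circle_def PiE_def)
  next
    fix \<phi> assume chi: "\<phi> \<in> ?R"
    then have ext: "\<phi> \<in> extensional (carrier G)" by (auto simp: top)
    have hom: "\<phi> \<in> hom G circle_group"
      using chi by (auto simp: hom_def K_def)
    have half: "\<phi> ` U \<subseteq> right_half_circle"
      using chi U by (auto simp: K_def right_half_circle_def)
    have "continuous_map T (top_of_set (sphere 0 1)) \<phi>"
      using hom V half by (intro hom_continuous_if_right_half[of _ V]) auto
    with ext hom half show "\<phi> \<in> polar U"
      by (auto simp: polar_def characters_def)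
  qed
  moreover have "closedin Y ?R"
  proof (intro closedin_Int clK)
    have one: "carrier G \<noteq> {}" by auto
    show "closedin Y (\<Inter>x\<in>carrier G. \<Inter>y\<in>carrier G. {\<phi> \<in> topspace Y. \<phi> (x \<otimes> y) = \<phi> x * \<phi> y})"
      using one eq by (intro closedin_INT) auto
    show "closedin Y (topspace Y)" by simp
    show "closedin Y (\<Inter>x\<in>U. {\<phi> \<in> topspace Y. Re (\<phi> x) \<ge> 0})"
      using re U V by (intro closedin_INT) auto
  qed
  ultimately have "compactin Y (polar U)"
    using K by (intro closed_compactin[OF K]) auto
  then show ?thesis by (simp add: Y_def)
qed

end

section \<open>Barrelled spaces are Mackey groups\<close>

text \<open>This translates bounds on phases, which are linear conditions, into conditions on characters,
  which are known to be continuous.\<close>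

lemma cos_line_nonneg_iff:
  "(\<forall>t. \<bar>t\<bar> \<le> 1 \<longrightarrow> cos (c * t) \<ge> 0) \<longleftrightarrow> \<bar>c\<bar> \<le> pi / 2"
proof
  assume R: "\<bar>c\<bar> \<le> pi / 2"
  show "\<forall>t. \<bar>t\<bar> \<le> 1 \<longrightarrow> cos (c * t) \<ge> 0"
  proof (intro allI impI)
    fix t :: real assume "\<bar>t\<bar> \<le> 1"
    then have "\<bar>c * t\<bar> \<le> pi / 2 * 1"
      unfolding abs_mult using R by (intro mult_mono) auto
    then show "cos (c * t) \<ge> 0"
      by (intro cos_ge_zero) auto
  qed
next
  assume L: "\<forall>t. \<bar>t\<bar> \<le> 1 \<longrightarrow> cos (c * t) \<ge> 0"
  show "\<bar>c\<bar> \<le> pi / 2"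
  proof (rule ccontr)
    assume c: "\<not> \<bar>c\<bar> \<le> pi / 2"
    \<comment> \<open>Shortening \<open>c\<close> to length at most \<open>pi\<close> brings the angle into the region where the cosine is negative.\<close>
    define m where "m = min \<bar>c\<bar> pi"
    have m: "pi / 2 < m" "m \<le> pi" "m \<le> \<bar>c\<bar>"
      using c by (auto simp: m_def)
    have "\<bar>m / \<bar>c\<bar>\<bar> \<le> 1"
      using m by (simp add: divide_le_eq)
    then have "cos \<bar>c * (m / \<bar>c\<bar>)\<bar> \<ge> 0"
      unfolding cos_abs_real using L by blast
    moreover have "\<bar>c * (m / \<bar>c\<bar>)\<bar> = m"
      using m by (simp add: abs_mult)
    moreover have "cos m < cos (pi / 2)"
      using m by (intro cos_monotone_0_pi) auto
    ultimately show False by simp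
  qed
qed

context locally_convex_space
begin

lemma abelian_topological_group_add_monoid: "abelian_topological_group (add_monoid E) T"
proof -
  have "continuous_map T (prod_topology euclideanreal T) (\<lambda>x. (-1, x))"
    by (intro continuous_intros) simp
  from continuous_map_compose[OF this continuous_smult]
  have "continuous_map T T (\<lambda>x. (-1) \<odot> x)"
    by (simp add: o_def)
  moreover have "(-1) \<odot> x = inv\<^bsub>add_monoid E\<^esub> x" if "x \<in> topspace T" for x
  proof -
    have x: "x \<in> carrier E" using that by (simp add: topspace_eq_carrier)
    have "(-1) \<odot> x \<oplus> x = ((-1) + 1) \<odot> x"
      using smult_l_distr[of "-1" 1 x] x smult_one[of x] by simp
    also have "\<dots> = \<zero>" using smult_l_null[OF x] by simp
    finally show ?thesis
      using x add.inv_equality[of "(-1) \<odot> x" x] by (simp add: a_inv_def)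
  qed
  ultimately have "continuous_map T T (\<lambda>x. inv\<^bsub>add_monoid E\<^esub> x)"
    by (rule continuous_map_eq)
  then show ?thesis
    using topspace_eq_carrier continuous_add a_comm_group
    by (intro abelian_topological_group.intro abelian_topological_group_axioms.intro) auto
qed

end

context locally_convex_space
begin

text \<open>The linear functional \<open>p\<close> with \<open>\<phi> = cis \<circ> p\<close>. It is determined only by the values of \<open>\<phi>\<close> on the
  whole line through \<open>x\<close>, not by \<open>\<phi> x\<close> alone.\<close>

definition phase :: "('a \<Rightarrow> complex) \<Rightarrow> 'a \<Rightarrow> real" where
  "phase \<phi> x = (THE c. \<forall>t. \<phi> (t \<odot> x) = cis (c * t))"

lemma phase_unique:
  assumes "\<And>t. \<phi> (t \<odot> x) = cis (c * t)"
  shows "phase \<phi> x = c"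
  unfolding phase_def using assms cis_line_eq_imp_eq by (intro the_equality) auto

lemma character_on_line:
  assumes chi: "\<phi> \<in> characters (add_monoid E) T" and x: "x \<in> carrier E"
  shows "\<phi> (t \<odot> x) = cis (phase \<phi> x * t)"
proof -
  have hom: "\<phi> \<in> hom (add_monoid E) circle_group"
    and cont: "continuous_map T (top_of_set (sphere 0 1)) \<phi>"
    using chi by (auto simp: characters_def)
  have "continuous_map euclideanreal (prod_topology euclideanreal T) (\<lambda>t. (t, x))"
    using x by (intro continuous_intros) (simp_all add: topspace_eq_carrier)
  from continuous_map_compose[OF this continuous_smult]
  have "continuous_map euclideanreal T (\<lambda>t. t \<odot> x)"
    by (simp add: o_def)
  moreover have "continuous_map T euclidean \<phi>"
    using cont by (simp add: continuous_map_in_subtopology)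
  ultimately have "continuous_map euclideanreal euclidean (\<phi> \<circ> (\<lambda>t. t \<odot> x))"
    by (rule continuous_map_compose)
  then have line: "continuous_on UNIV (\<lambda>t. \<phi> (t \<odot> x))"
    by (simp add: o_def)
  obtain c where c: "\<And>t. \<phi> (t \<odot> x) = cis (c * t)"
  proof (rule one_parameter_subgroup_of_circle[OF line])
    show "\<phi> ((s + t) \<odot> x) = \<phi> (s \<odot> x) * \<phi> (t \<odot> x)" for s t
      using smult_l_distr[of s t x] hom_mult[OF hom, of "s \<odot> x" "t \<odot> x"] x by simp
    show "norm (\<phi> (t \<odot> x)) = 1" for t
      using hom_in_carrier[OF hom, of "t \<odot> x"] x by simp
  qed blast
  show ?thesis
    using c phase_unique[of \<phi> x c] by simp
qed

lemma phase_add: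
  assumes chi: "\<phi> \<in> characters (add_monoid E) T" and x: "x \<in> carrier E" and y: "y \<in> carrier E"
  shows "phase \<phi> (x \<oplus> y) = phase \<phi> x + phase \<phi> y"
proof (rule phase_unique)
  fix t
  have hom: "\<phi> \<in> hom (add_monoid E) circle_group"
    using chi by (auto simp: characters_def)
  have "\<phi> (t \<odot> (x \<oplus> y)) = \<phi> (t \<odot> x) * \<phi> (t \<odot> y)"
    using smult_r_distr[of t x y] hom_mult[OF hom, of "t \<odot> x" "t \<odot> y"] x y by simp
  then show "\<phi> (t \<odot> (x \<oplus> y)) = cis ((phase \<phi> x + phase \<phi> y) * t)"
    using character_on_line[OF chi] x y by (simp add: cis_mult algebra_simps)
qed

lemma phase_smult:
  assumes chi: "\<phi> \<in> characters (add_monoid E) T" and x: "x \<in> carrier E"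
  shows "phase \<phi> (s \<odot> x) = s * phase \<phi> x"
proof (rule phase_unique)
  fix t
  have "t \<odot> (s \<odot> x) = (t * s) \<odot> x"
    using smult_assoc1[of t s x] x by simp
  then show "\<phi> (t \<odot> (s \<odot> x)) = cis (s * phase \<phi> x * t)"
    using character_on_line[OF chi x, of "t * s"] by (simp add: mult_ac)
qed

text \<open>The bound on the phase says that \<open>\<phi>\<close> maps the segment from \<open>- x\<close> to \<open>x\<close> into the right half
  circle, which is a closed condition on \<open>x\<close>.\<close>

lemma closedin_phase_bounded:
  assumes chi: "\<phi> \<in> characters (add_monoid E) T"
  shows "closedin T {x \<in> carrier E. \<bar>phase \<phi> x\<bar> \<le> pi / 2}"
proof -
  have cont: "continuous_map T euclidean \<phi>"
    using chi by (auto simp: characters_def continuous_map_in_subtopology)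
  have clo: "closedin T {x \<in> carrier E. Re (\<phi> (t \<odot> x)) \<ge> 0}" for t
  proof -
    have "continuous_map T (prod_topology euclideanreal T) (\<lambda>x. (t, x))"
      by (intro continuous_intros) simp
    from continuous_map_compose[OF this continuous_smult]
    have "continuous_map T T (\<lambda>x. t \<odot> x)"
      by (simp add: o_def)
    from continuous_map_compose[OF this cont]
    have "continuous_map T euclidean (\<lambda>x. \<phi> (t \<odot> x))"
      by (simp add: o_def)
    moreover have "closed {z. Re z \<ge> 0}" by (rule closed_halfspace_Re_ge)
    ultimately show ?thesis
      using closedin_continuous_map_preimage[of T euclidean "\<lambda>x. \<phi> (t \<odot> x)" "{z. Re z \<ge> 0}"]
      by (simp add: topspace_eq_carrier)
  qed
  have "{x \<in> carrier E. \<bar>phase \<phi> x\<bar> \<le> pi / 2} =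
      (\<Inter>t\<in>{-1..1}. {x \<in> carrier E. Re (\<phi> (t \<odot> x)) \<ge> 0})" (is "_ = ?R")
  proof -
    have "\<bar>phase \<phi> x\<bar> \<le> pi / 2 \<longleftrightarrow> (\<forall>t\<in>{-1..1}. Re (\<phi> (t \<odot> x)) \<ge> 0)" if "x \<in> carrier E" for x
      unfolding cos_line_nonneg_iff[symmetric] using character_on_line[OF chi that]
      by (auto simp: abs_le_iff)
    moreover have "0 \<in> {- 1..1 :: real}" by simp
    ultimately show ?thesis by blast
  qed
  moreover have "closedin T ?R"
    using clo by (intro closedin_INT) auto
  ultimately show ?thesis by simp
qed

lemma barrel_of_bounded_phases:
  assumes P: "P \<subseteq> characters (add_monoid E) T"
    and bdd: "\<And>x. x \<in> carrier E \<Longrightarrow> bounded ((\<lambda>\<phi>. phase \<phi> x) ` P)"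
  shows "barrel E T {x \<in> carrier E. \<forall>\<phi>\<in>P. \<bar>phase \<phi> x\<bar> \<le> pi / 2}" (is "barrel E T ?B")
  unfolding barrel_def
proof (intro conjI)
  have "?B = topspace T \<inter> (\<Inter>\<phi>\<in>P. {x \<in> carrier E. \<bar>phase \<phi> x\<bar> \<le> pi / 2})"
    by (auto simp: topspace_eq_carrier)
  also have "closedin T \<dots>"
  proof (cases "P = {}")
    case False
    then show ?thesis
      using P closedin_phase_bounded by (intro closedin_Int closedin_INT) auto
  qed simp
  finally show "closedin T ?B" .
  show "convex_in E ?B"
    unfolding convex_in_def
  proof (intro conjI ballI)
    fix x y and t :: real assume x: "x \<in> ?B" and y: "y \<in> ?B" and t: "t \<in> {0..1}"
    have "\<bar>phase \<phi> (((1 - t) \<odot> x) \<oplus> (t \<odot> y))\<bar> \<le> pi / 2" if "\<phi> \<in> P" for \<phi>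
    proof -
      have chi: "\<phi> \<in> characters (add_monoid E) T" using P that by auto
      have "phase \<phi> (((1 - t) \<odot> x) \<oplus> (t \<odot> y)) = (1 - t) * phase \<phi> x + t * phase \<phi> y"
        using x y chi by (simp add: phase_add phase_smult)
      also have "\<bar>\<dots>\<bar> \<le> (1 - t) * \<bar>phase \<phi> x\<bar> + t * \<bar>phase \<phi> y\<bar>"
        using t abs_triangle_ineq[of "(1 - t) * phase \<phi> x" "t * phase \<phi> y"] by (simp add: abs_mult)
      also have "\<dots> \<le> (1 - t) * (pi / 2) + t * (pi / 2)"
        using t x y that by (intro add_mono mult_left_mono) auto
      also have "\<dots> = pi / 2" by (simp add: field_simps)
      finally show ?thesis .
    qed
    then show "((1 - t) \<odot> x) \<oplus> (t \<odot> y) \<in> ?B"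
      using x y by simp
  qed auto
  show "balanced_in E ?B"
    unfolding balanced_in_def
  proof (intro conjI ballI allI impI)
    fix x and t :: real assume x: "x \<in> ?B" and t: "\<bar>t\<bar> \<le> 1"
    have "\<bar>phase \<phi> (t \<odot> x)\<bar> \<le> pi / 2" if "\<phi> \<in> P" for \<phi>
    proof -
      have "\<bar>phase \<phi> (t \<odot> x)\<bar> = \<bar>t\<bar> * \<bar>phase \<phi> x\<bar>"
        using P that x by (subst phase_smult) (auto simp: abs_mult)
      also have "\<dots> \<le> 1 * (pi / 2)"
        using t x that by (intro mult_mono) auto
      finally show ?thesis by simp
    qed
    then show "t \<odot> x \<in> ?B" using x by simp
  qed auto
  show "absorbing_in E ?B"
    unfolding absorbing_in_def
  proof (intro conjI ballI)
    fix x assume x: "x \<in> carrier E"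
    obtain C where C: "C > 0" "\<And>\<phi>. \<phi> \<in> P \<Longrightarrow> \<bar>phase \<phi> x\<bar> \<le> C"
      using bdd[OF x] by (auto simp: bounded_pos)
    show "\<exists>r>0. \<forall>t. \<bar>t\<bar> \<le> r \<longrightarrow> t \<odot> x \<in> ?B"
    proof (intro exI[of _ "pi / 2 / C"] conjI allI impI)
      fix t assume t: "\<bar>t\<bar> \<le> pi / 2 / C"
      have "\<bar>phase \<phi> (t \<odot> x)\<bar> \<le> pi / 2" if "\<phi> \<in> P" for \<phi>
      proof -
        have "\<bar>phase \<phi> (t \<odot> x)\<bar> = \<bar>t\<bar> * \<bar>phase \<phi> x\<bar>"
          using P that x by (subst phase_smult) (auto simp: abs_mult)
        also have "\<dots> \<le> pi / 2 / C * C"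
          using t C that by (intro mult_mono) auto
        finally show ?thesis using C by simp
      qed
      then show "t \<odot> x \<in> ?B" using x by simp
    qed (use C in simp)
  qed auto
qed

text \<open>Restriction to the line through \<open>x\<close> carries the pointwise compact polar to a pointwise compact
  set of characters of the reals. Compatibility of the topologies enters here: it makes the members
  of the polar formed with \<open>S\<close> continuous for the vector topology, so that they have phases.\<close>

lemma bounded_phases_of_polar:
  assumes S: "abelian_topological_group (add_monoid E) S"
    and comp: "compatible_topologies (add_monoid E) T S"
    and V: "openin S V" "\<zero> \<in> V" "V \<subseteq> U" and U: "U \<subseteq> carrier E"
    and x: "x \<in> carrier E"
  shows "bounded ((\<lambda>\<phi>. phase \<phi> x) ` abelian_topological_group.polar (add_monoid E) S U)"
    (is "bounded (_ ` ?P)")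
proof (rule bounded_if_characters_compact)
  interpret S: abelian_topological_group "add_monoid E" S by (rule S)
  have P: "?P \<subseteq> characters (add_monoid E) T"
    using comp by (auto simp: S.polar_def compatible_topologies_def)
  have "continuous_map (product_topology (\<lambda>_. euclidean :: complex topology) (carrier E))
      (product_topology (\<lambda>_::real. euclidean) UNIV) (\<lambda>\<phi> t. \<phi> (t \<odot> x))"
    using x by (auto simp: continuous_map_componentwise_UNIV intro!: continuous_map_product_projection)
  moreover have "compactin (product_topology (\<lambda>_. euclidean) (carrier E)) ?P"
    using S.compact_polar[of V U] V U by simp
  ultimately have "compact ((\<lambda>\<phi> t. \<phi> (t \<odot> x)) ` ?P)"
    using image_compactin by (fastforce simp: euclidean_product_topology)
  moreover have "(\<lambda>\<phi> t. \<phi> (t \<odot> x)) ` ?P = (\<lambda>s t. cis (s * t)) ` (\<lambda>\<phi>. phase \<phi> x) ` ?P"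
    unfolding image_image using P x by (intro image_cong refl ext character_on_line) auto
  ultimately show "compact ((\<lambda>s t. cis (s * t)) ` (\<lambda>\<phi>. phase \<phi> x) ` ?P)"
    by simp
qed

lemma barrel_in_quasi_convex_neighbourhood:
  assumes S: "abelian_topological_group (add_monoid E) S"
    and comp: "compatible_topologies (add_monoid E) T S"
    and V: "openin S V" "\<zero> \<in> V" "V \<subseteq> U" and U: "quasi_convex (add_monoid E) S U"
  obtains B where "barrel E T B" "B \<subseteq> U"
proof -
  interpret S: abelian_topological_group "add_monoid E" S by (rule S)
  have UE: "U \<subseteq> carrier E"
    using U by (auto simp: quasi_convex_def)
  have P: "S.polar U \<subseteq> characters (add_monoid E) T"
    using comp by (auto simp: S.polar_def compatible_topologies_def)
  define B where "B = {x \<in> carrier E. \<forall>\<phi>\<in>S.polar U. \<bar>phase \<phi> x\<bar> \<le> pi / 2}"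
  have "barrel E T B"
    unfolding B_def using bounded_phases_of_polar[OF S comp V UE] P
    by (intro barrel_of_bounded_phases)
  moreover have "B \<subseteq> U"
  proof
    fix x assume x: "x \<in> B"
    then have xE: "x \<in> carrier E" by (simp add: B_def)
    show "x \<in> U"
    proof (rule ccontr)
      assume "x \<notin> U"
      then obtain \<phi> where chi: "\<phi> \<in> characters (add_monoid E) S" "\<phi> x \<notin> right_half_circle"
          "\<phi> ` U \<subseteq> right_half_circle"
        using U xE unfolding quasi_convex_def by (metis DiffI monoid.simps(1) partial_object.simps(1))
      then have pol: "\<phi> \<in> S.polar U" by (auto simp: S.polar_def)
      have "\<phi> x = cis (phase \<phi> x)"
        using character_on_line[of \<phi> x 1] P pol xE smult_one[of x] by auto
      moreover have "cos (phase \<phi> x) \<ge> 0"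
        using x pol by (intro cos_ge_zero) (auto simp: B_def abs_le_iff)
      ultimately show False using chi(2) by (simp add: right_half_circle_def)
    qed
  qed
  ultimately show thesis using that by blast
qed

end

text \<open>Every point of a set that is open in the compatible topology is interior for the vector
  topology: after translation to zero, the set contains a quasi-convex neighbourhood and hence a
  barrel.\<close>

theorem barrelled_imp_Mackey_group:
  fixes E (structure)
  assumes barrelled: "barrelled_space E T"
    and lqc: "locally_quasi_convex_group (add_monoid E) T"
  shows "Mackey_group (add_monoid E) T"
  unfolding Mackey_group_def
proof (intro conjI lqc allI impI, elim conjE)
  fix S W
  assume lqcS: "locally_quasi_convex_group (add_monoid E) S"
    and comp: "compatible_topologies (add_monoid E) T S"
    and W: "openin S W"
  interpret locally_convex_space E T
    using barrelled by (simp add: barrelled_space_def)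
  interpret T: abelian_topological_group "add_monoid E" T
    using lqc by (simp add: locally_quasi_convex_group_def)
  interpret S: abelian_topological_group "add_monoid E" S
    using lqcS by (simp add: locally_quasi_convex_group_def)
  show "openin T W"
  proof (subst openin_subopen, intro ballI)
    fix x assume x: "x \<in> W"
    then have xE: "x \<in> carrier E"
      using openin_subset[OF W] S.topspace_eq_carrier by auto
    define W' where "W' = {y \<in> carrier E. x \<oplus> y \<in> W}"
    have "openin S W'"
      using S.openin_translation[OF _ W, of x] xE by (simp add: W'_def)
    moreover have "\<zero> \<in> W'"
      using x xE by (simp add: W'_def)
    ultimately obtain V U where VU: "openin S V" "quasi_convex (add_monoid E) S U"
        "\<zero> \<in> V" "V \<subseteq> U" "U \<subseteq> W'"
      using lqcS by (auto simp: locally_quasi_convex_group_def neighbourhood_base_at_def)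
    then obtain B where B: "barrel E T B" "B \<subseteq> U"
      using barrel_in_quasi_convex_neighbourhood[OF S.abelian_topological_group_axioms comp]
      by metis
    then obtain O' where O': "openin T O'" "\<zero> \<in> O'" "O' \<subseteq> B"
      using barrelled by (auto simp: barrelled_space_def)
    define N where "N = {z \<in> carrier E. \<ominus> x \<oplus> z \<in> O'}"
    have "openin T N"
      using T.openin_translation[OF _ O'(1), of "\<ominus> x"] xE by (simp add: N_def)
    moreover have "x \<in> N"
      using xE O'(2) by (simp add: N_def l_neg)
    moreover have "N \<subseteq> W"
    proof
      fix z assume "z \<in> N"
      then have z: "z \<in> carrier E" "\<ominus> x \<oplus> z \<in> W'"
        using O'(3) B(2) VU(5) by (auto simp: N_def)
      then have "x \<oplus> (\<ominus> x \<oplus> z) \<in> W" by (simp add: W'_def)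
      then show "z \<in> W"
        using xE z(1) by (simp add: r_neg2)
    qed
    ultimately show "\<exists>N. openin T N \<and> x \<in> N \<and> N \<subseteq> W" by blast
  qed
qed

section \<open>The group and vector space structure of $C_k(X)$\<close>

lemma function_space_simps [simp]:
  "carrier (function_space X) = continuous_functions X"
  "\<zero>\<^bsub>function_space X\<^esub> = (\<lambda>x\<in>topspace X. 0)"
  "f \<oplus>\<^bsub>function_space X\<^esub> g = (\<lambda>x\<in>topspace X. f x + g x)"
  "t \<odot>\<^bsub>function_space X\<^esub> f = (\<lambda>x\<in>topspace X. t * f x)"
  by (simp_all add: function_space_def)

lemma continuous_functions_imp_continuous_map:
  "f \<in> continuous_functions X \<Longrightarrow> continuous_map X euclideanreal f"
  by (simp add: continuous_functions_def)

definition uniform_nbhd :: "'a topology \<Rightarrow> 'a set \<Rightarrow> real \<Rightarrow> ('a \<Rightarrow> real) \<Rightarrow> ('a \<Rightarrow> real) set" where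
  "uniform_nbhd X K e f = {g \<in> continuous_functions X. \<forall>x\<in>K. \<bar>g x - f x\<bar> < e}"

text \<open>The sets in question are neighbourhoods in the compact-open topology: covering \<open>f ` K\<close> by
  finitely many small balls splits \<open>K\<close> into compact pieces on which \<open>f\<close> is almost constant, and one
  subbasic set for each piece keeps \<open>g\<close> close to \<open>f\<close>.\<close>

lemma uniform_nbhd_contains_openin:
  assumes f: "f \<in> continuous_functions X" and K: "compactin X K" and e: "e > 0"
  obtains W where "openin (compact_open_topology X) W" "f \<in> W" "W \<subseteq> uniform_nbhd X K e f"
proof -
  have cont: "continuous_map X euclideanreal f"
    using f by (rule continuous_functions_imp_continuous_map)
  have "compact (f ` K)"
    using image_compactin[OF K cont] by simp
  then obtain A where A: "finite A" "A \<subseteq> f ` K" "f ` K \<subseteq> (\<Union>a\<in>A. ball a (e / 3))"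
    using e by (rule_tac compactE_image[of "f ` K" "f ` K" "\<lambda>a. ball a (e / 3)"]) auto
  define P where "P a = {x \<in> topspace X. f x \<in> cball a (e / 3)} \<inter> K" for a
  define V where "V a = {g \<in> continuous_functions X. g ` P a \<subseteq> ball a (e / 2)}" for a
  define W where "W = (\<Inter>a\<in>A. V a) \<inter> topspace (compact_open_topology X)"
  have P: "compactin X (P a)" for a
    unfolding P_def using closedin_continuous_map_preimage[OF cont, of "cball a (e / 3)"] K
    by (intro closed_Int_compactin) auto
  have "openin (compact_open_topology X) (V a)" for a
    unfolding compact_open_topology_def V_def
    by (rule topology_generated_by_Basis) (use P in blast)
  then have "openin (compact_open_topology X) W"
    unfolding W_def using A(1) by (intro openin_INT) auto
  moreover have "f \<in> W"
    using f e by (auto simp: W_def V_def P_def topspace_compact_open_topology)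
  moreover have "W \<subseteq> uniform_nbhd X K e f"
  proof
    fix g assume g: "g \<in> W"
    then have gC: "g \<in> continuous_functions X" by (simp add: W_def topspace_compact_open_topology)
    have "\<bar>g x - f x\<bar> < e" if x: "x \<in> K" for x
    proof -
      obtain a where a: "a \<in> A" "f x \<in> ball a (e / 3)"
        using A(3) x by blast
      then have "x \<in> P a"
        using x compactin_subset_topspace[OF K] by (auto simp: P_def)
      moreover have "g ` P a \<subseteq> ball a (e / 2)"
        using g a(1) by (auto simp: W_def V_def)
      ultimately have "g x \<in> ball a (e / 2)" by blast
      then show ?thesis
        using a(2) e unfolding mem_ball dist_real_def by linarith
    qed
    then show "g \<in> uniform_nbhd X K e f"
      using gC by (simp add: uniform_nbhd_def)
  qed
  ultimately show thesis by (rule that)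
qed

lemma openin_compact_open_contains_uniform_nbhd:
  assumes "openin (compact_open_topology X) U" "f \<in> U"
  shows "\<exists>K e. compactin X K \<and> e > 0 \<and> uniform_nbhd X K e f \<subseteq> U"
proof -
  have "generate_topology_on {{f \<in> continuous_functions X. f ` K \<subseteq> V} | K V. compactin X K \<and> open V} U"
    using assms(1) unfolding compact_open_topology_def by (rule openin_topology_generated_by)
  then show ?thesis
    using assms(2)
  proof (induction arbitrary: f rule: generate_topology_on.induct)
    case (Int U V)
    obtain K d where K: "compactin X K" "d > 0" "uniform_nbhd X K d f \<subseteq> U"
      using Int by blast
    obtain L e where L: "compactin X L" "e > 0" "uniform_nbhd X L e f \<subseteq> V"
      using Int by blast
    have "uniform_nbhd X (K \<union> L) (min d e) f \<subseteq> U \<inter> V"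
      using K(3) L(3) by (fastforce simp: uniform_nbhd_def)
    then show ?case
      using K L by (intro exI[of _ "K \<union> L"] exI[of _ "min d e"]) (auto intro: compactin_Un)
  next
    case (UN \<U>)
    then obtain U where "U \<in> \<U>" "f \<in> U" by blast
    then show ?case using UN.IH by blast
  next
    case (Basis S)
    then obtain K V where K: "compactin X K" and V: "open V"
      and S: "S = {f \<in> continuous_functions X. f ` K \<subseteq> V}" by blast
    have f: "f \<in> continuous_functions X" "f ` K \<subseteq> V" using Basis S by auto
    have "compact (f ` K)"
      using image_compactin[OF K continuous_functions_imp_continuous_map[OF f(1)]] by simp
    moreover have "closed (- V)" "f ` K \<inter> - V = {}" using V f(2) by auto
    ultimately obtain d where d: "d > 0" "\<forall>x\<in>f ` K. \<forall>y\<in>- V. d \<le> dist x y"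
      using separate_compact_closed by metis
    have "uniform_nbhd X K d f \<subseteq> S"
    proof
      fix g assume g: "g \<in> uniform_nbhd X K d f"
      have "g x \<in> V" if x: "x \<in> K" for x
      proof (rule ccontr)
        assume "g x \<notin> V"
        then have "d \<le> dist (f x) (g x)" using d(2) x by blast
        moreover have "\<bar>g x - f x\<bar> < d" using g x by (auto simp: uniform_nbhd_def)
        ultimately show False by (simp add: dist_real_def)
      qed
      then show "g \<in> S" using g by (auto simp: S uniform_nbhd_def)
    qed
    then show ?case using K d(1) by blast
  qed simp
qed

lemma openin_compact_open_subset:
  "openin (compact_open_topology X) U \<Longrightarrow> U \<subseteq> continuous_functions X"
  using openin_subset by (force simp: topspace_compact_open_topology)

lemma continuous_map_into_compact_openI:
  assumes "\<And>p. p \<in> topspace Y \<Longrightarrow> h p \<in> continuous_functions X"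
    and "\<And>p K e. \<lbrakk>p \<in> topspace Y; compactin X K; e > 0\<rbrakk> \<Longrightarrow>
      \<exists>W. openin Y W \<and> p \<in> W \<and> (\<forall>q\<in>W. \<forall>x\<in>K. \<bar>h q x - h p x\<bar> < e)"
  shows "continuous_map Y (compact_open_topology X) h"
  unfolding continuous_map_eq_topcontinuous_at topcontinuous_at_def
proof (intro ballI conjI allI impI)
  fix p assume p: "p \<in> topspace Y"
  show "p \<in> topspace Y" "h \<in> topspace Y \<rightarrow> topspace (compact_open_topology X)"
    using p assms(1) by (auto simp: topspace_compact_open_topology)
  fix V assume "openin (compact_open_topology X) V \<and> h p \<in> V"
  then obtain K e where K: "compactin X K" "e > 0" "uniform_nbhd X K e (h p) \<subseteq> V"
    using openin_compact_open_contains_uniform_nbhd by blast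
  obtain W where W: "openin Y W" "p \<in> W" "\<And>q x. \<lbrakk>q \<in> W; x \<in> K\<rbrakk> \<Longrightarrow> \<bar>h q x - h p x\<bar> < e"
    using assms(2)[OF p K(1,2)] by blast
  have "h q \<in> V" if q: "q \<in> W" for q
  proof -
    have "h q \<in> continuous_functions X"
      using q openin_subset[OF W(1)] assms(1) by blast
    then have "h q \<in> uniform_nbhd X K e (h p)"
      using W(3)[OF q] by (simp add: uniform_nbhd_def)
    then show ?thesis using K(3) by blast
  qed
  then show "\<exists>U. openin Y U \<and> p \<in> U \<and> (\<forall>y\<in>U. h y \<in> V)" using W by blast
qed

lemma continuous_add_compact_open:
  "continuous_map (prod_topology (compact_open_topology X) (compact_open_topology X))
     (compact_open_topology X) (\<lambda>(f, g). f \<oplus>\<^bsub>function_space X\<^esub> g)"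
proof (rule continuous_map_into_compact_openI)
  fix p assume "p \<in> topspace (prod_topology (compact_open_topology X) (compact_open_topology X))"
  then obtain f g where p: "p = (f, g)" "f \<in> continuous_functions X" "g \<in> continuous_functions X"
    by (auto simp: topspace_compact_open_topology)
  show "(case p of (f, g) \<Rightarrow> f \<oplus>\<^bsub>function_space X\<^esub> g) \<in> continuous_functions X"
    using p by (simp add: restrict_in_continuous_functions continuous_map_add
        continuous_functions_imp_continuous_map)
  fix K and e :: real assume K: "compactin X K" and e: "e > 0"
  obtain W1 where W1: "openin (compact_open_topology X) W1" "f \<in> W1" "W1 \<subseteq> uniform_nbhd X K (e/2) f"
    using uniform_nbhd_contains_openin[OF p(2) K, of "e/2"] e by auto
  obtain W2 where W2: "openin (compact_open_topology X) W2" "g \<in> W2" "W2 \<subseteq> uniform_nbhd X K (e/2) g"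
    using uniform_nbhd_contains_openin[OF p(3) K, of "e/2"] e by auto
  have "\<bar>(f' \<oplus>\<^bsub>function_space X\<^esub> g') x - (f \<oplus>\<^bsub>function_space X\<^esub> g) x\<bar> < e"
    if "f' \<in> W1" "g' \<in> W2" "x \<in> K" for f' g' x
  proof -
    have "\<bar>f' x - f x\<bar> < e/2" "\<bar>g' x - g x\<bar> < e/2"
      using W1(3) W2(3) that by (auto simp: uniform_nbhd_def)
    then have "\<bar>f' x + g' x - (f x + g x)\<bar> < e" by linarith
    then show ?thesis
      using that(3) compactin_subset_topspace[OF K] by (auto simp: subset_iff)
  qed
  then show "\<exists>W. openin (prod_topology (compact_open_topology X) (compact_open_topology X)) W \<and> p \<in> W \<and>
      (\<forall>q\<in>W. \<forall>x\<in>K. \<bar>(case q of (f, g) \<Rightarrow> f \<oplus>\<^bsub>function_space X\<^esub> g) x -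
        (case p of (f, g) \<Rightarrow> f \<oplus>\<^bsub>function_space X\<^esub> g) x\<bar> < e)"
    using W1 W2 p(1)
    by (intro exI[of _ "W1 \<times> W2"]) (auto simp: openin_prod_Times_iff simp del: function_space_simps)
qed

lemma continuous_smult_compact_open:
  "continuous_map (prod_topology euclideanreal (compact_open_topology X))
     (compact_open_topology X) (\<lambda>(t, f). t \<odot>\<^bsub>function_space X\<^esub> f)"
proof (rule continuous_map_into_compact_openI)
  fix p :: "real \<times> ('a \<Rightarrow> real)"
  assume "p \<in> topspace (prod_topology euclideanreal (compact_open_topology X))"
  then obtain t f where p: "p = (t, f)" "f \<in> continuous_functions X"
    by (auto simp: topspace_compact_open_topology)
  show "(case p of (t, f) \<Rightarrow> t \<odot>\<^bsub>function_space X\<^esub> f) \<in> continuous_functions X"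
    using p by (simp add: restrict_in_continuous_functions continuous_map_real_mult_left
        continuous_functions_imp_continuous_map)
  fix K and e :: real assume K: "compactin X K" and e: "e > 0"
  have "compact (f ` K)"
    using image_compactin[OF K continuous_functions_imp_continuous_map[OF p(2)]] by simp
  then obtain M where M: "M > 0" "\<And>x. x \<in> K \<Longrightarrow> \<bar>f x\<bar> \<le> M"
    using compact_imp_bounded[of "f ` K"] by (auto simp: bounded_pos)
  define d where "d = min 1 (e / (2 * M))"
  have d: "d > 0" "d \<le> 1" "d \<le> e / (2 * M)" using e M(1) by (auto simp: d_def)
  define c where "c = e / (2 * (\<bar>t\<bar> + 1))"
  have c: "c > 0" unfolding c_def using e by (intro divide_pos_pos) auto
  obtain W where W: "openin (compact_open_topology X) W" "f \<in> W" "W \<subseteq> uniform_nbhd X K c f"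
    using uniform_nbhd_contains_openin[OF p(2) K c] by blast
  have "\<bar>(s \<odot>\<^bsub>function_space X\<^esub> g) x - (t \<odot>\<^bsub>function_space X\<^esub> f) x\<bar> < e"
    if "s \<in> ball t d" "g \<in> W" "x \<in> K" for s g x
  proof -
    have g: "\<bar>g x - f x\<bar> < c" using W(3) that by (auto simp: uniform_nbhd_def)
    have s: "\<bar>s - t\<bar> < d" using that(1) by (auto simp: dist_real_def)
    then have s1: "\<bar>s\<bar> \<le> \<bar>t\<bar> + 1" using d(2) by linarith
    have "s * g x - t * f x = s * (g x - f x) + (s - t) * f x"
      by (simp add: algebra_simps)
    then have "\<bar>s * g x - t * f x\<bar> \<le> \<bar>s\<bar> * \<bar>g x - f x\<bar> + \<bar>s - t\<bar> * \<bar>f x\<bar>"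
      using abs_triangle_ineq[of "s * (g x - f x)" "(s - t) * f x"] by (simp add: abs_mult)
    moreover have "\<bar>s\<bar> * \<bar>g x - f x\<bar> \<le> (\<bar>t\<bar> + 1) * \<bar>g x - f x\<bar>"
      using s1 by (intro mult_right_mono) auto
    moreover have "(\<bar>t\<bar> + 1) * \<bar>g x - f x\<bar> < (\<bar>t\<bar> + 1) * c"
      using g by (intro mult_strict_left_mono) auto
    moreover have "(\<bar>t\<bar> + 1) * c = e / 2"
      by (simp add: c_def field_simps add_nonneg_eq_0_iff)
    moreover have "\<bar>s - t\<bar> * \<bar>f x\<bar> \<le> e / (2 * M) * M"
      using s d M that(3) by (intro mult_mono) auto
    moreover have "e / (2 * M) * M = e / 2" using M(1) by simp
    ultimately have "\<bar>s * g x - t * f x\<bar> < e" by linarith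
    then show ?thesis
      using that(3) compactin_subset_topspace[OF K] by (auto simp: subset_iff)
  qed
  then show "\<exists>W. openin (prod_topology euclideanreal (compact_open_topology X)) W \<and> p \<in> W \<and>
      (\<forall>q\<in>W. \<forall>x\<in>K. \<bar>(case q of (t, f) \<Rightarrow> t \<odot>\<^bsub>function_space X\<^esub> f) x -
        (case p of (t, f) \<Rightarrow> t \<odot>\<^bsub>function_space X\<^esub> f) x\<bar> < e)"
    using W p(1) d(1)
    by (intro exI[of _ "ball t d \<times> W"]) (auto simp: openin_prod_Times_iff simp del: function_space_simps)
qed

lemma locally_convex_function_space:
  "locally_convex_space (function_space X) (compact_open_topology X)"
proof (intro locally_convex_space.intro locally_convex_space_axioms.intro module_function_space
    continuous_add_compact_open continuous_smult_compact_open)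
  show "topspace (compact_open_topology X) = carrier (function_space X)"
    by (simp add: topspace_compact_open_topology)
  show "neighbourhood_base_at \<zero>\<^bsub>function_space X\<^esub> (convex_in (function_space X)) (compact_open_topology X)"
    unfolding neighbourhood_base_at_def
  proof (intro allI impI, elim conjE)
    fix U assume U: "openin (compact_open_topology X) U" "\<zero>\<^bsub>function_space X\<^esub> \<in> U"
    obtain K e where K: "compactin X K" "e > 0" "uniform_nbhd X K e \<zero>\<^bsub>function_space X\<^esub> \<subseteq> U"
      using openin_compact_open_contains_uniform_nbhd[OF U] by blast
    have zero: "\<zero>\<^bsub>function_space X\<^esub> \<in> continuous_functions X"
      using openin_compact_open_subset[OF U(1)] U(2) by blast
    obtain W where W: "openin (compact_open_topology X) W" "\<zero>\<^bsub>function_space X\<^esub> \<in> W"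
        "W \<subseteq> uniform_nbhd X K e \<zero>\<^bsub>function_space X\<^esub>"
      using uniform_nbhd_contains_openin[OF zero K(1,2)] by blast
    have KX: "x \<in> topspace X" if "x \<in> K" for x
      using that compactin_subset_topspace[OF K(1)] by auto
    have "convex_in (function_space X) (uniform_nbhd X K e \<zero>\<^bsub>function_space X\<^esub>)"
      unfolding convex_in_def
    proof (intro conjI ballI)
      fix f g and t :: real
      assume f: "f \<in> uniform_nbhd X K e \<zero>\<^bsub>function_space X\<^esub>"
        and g: "g \<in> uniform_nbhd X K e \<zero>\<^bsub>function_space X\<^esub>" and t: "t \<in> {0..1}"
      have "(\<lambda>x\<in>topspace X. (1 - t) * f x + t * g x) \<in> continuous_functions X"
        using f g by (intro restrict_in_continuous_functions continuous_map_add
          continuous_map_real_mult_left continuous_functions_imp_continuous_map)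
          (auto simp: uniform_nbhd_def)
      moreover have "\<bar>(1 - t) * f x + t * g x\<bar> < e" if x: "x \<in> K" for x
      proof -
        have fg: "\<bar>f x\<bar> < e" "\<bar>g x\<bar> < e"
          using f g x KX[OF x] by (auto simp: uniform_nbhd_def)
        have "(1 - t) * f x + t * g x \<in> ball 0 e"
          using convex_ball[of "0::real" e] fg t
          unfolding convex_alt by (simp add: dist_real_def)
        then show ?thesis by (simp add: dist_real_def)
      qed
      ultimately show "(1 - t) \<odot>\<^bsub>function_space X\<^esub> f \<oplus>\<^bsub>function_space X\<^esub> t \<odot>\<^bsub>function_space X\<^esub> g
          \<in> uniform_nbhd X K e \<zero>\<^bsub>function_space X\<^esub>"
        using KX by (simp add: uniform_nbhd_def cong: restrict_cong)
    qed (auto simp: uniform_nbhd_def)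
    then show "\<exists>V P. openin (compact_open_topology X) V \<and> convex_in (function_space X) P \<and>
        \<zero>\<^bsub>function_space X\<^esub> \<in> V \<and> V \<subseteq> P \<and> P \<subseteq> U"
      using W K(3) by blast
  qed
qed

lemma evaluation_character:
  assumes x: "x \<in> topspace X"
  shows "(\<lambda>f\<in>continuous_functions X. cis (c * f x))
    \<in> characters (add_monoid (function_space X)) (compact_open_topology X)" (is "?\<phi> \<in> _")
proof -
  have "continuous_map (compact_open_topology X) euclideanreal (\<lambda>f. f x)"
    unfolding continuous_map_into_euclidean_metric
  proof (intro ballI allI impI)
    fix f and e :: real assume f: "f \<in> topspace (compact_open_topology X)" and e: "e > 0"
    then have "f \<in> continuous_functions X" by (simp add: topspace_compact_open_topology)
    moreover have "compactin X {x}" using x by simp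
    ultimately obtain W where "openin (compact_open_topology X) W" "f \<in> W"
        "W \<subseteq> uniform_nbhd X {x} e f"
      using e by (rule uniform_nbhd_contains_openin)
    then show "\<exists>U. openin (compact_open_topology X) U \<and> f \<in> U \<and> (\<forall>g\<in>U. dist (f x) (g x) < e)"
      by (intro exI[of _ W]) (auto simp: uniform_nbhd_def dist_real_def)
  qed
  moreover have "continuous_map euclideanreal euclidean (\<lambda>t. cis (c * t))"
    by (auto intro!: continuous_intros)
  ultimately have "continuous_map (compact_open_topology X) euclidean ((\<lambda>t. cis (c * t)) \<circ> (\<lambda>f. f x))"
    by (rule continuous_map_compose)
  then have "continuous_map (compact_open_topology X) euclidean ?\<phi>"
    by (rule continuous_map_eq) (simp add: topspace_compact_open_topology)
  then have "continuous_map (compact_open_topology X) (top_of_set (sphere 0 1)) ?\<phi>"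
    by (auto simp: continuous_map_in_subtopology topspace_compact_open_topology)
  moreover have "?\<phi> \<in> hom (add_monoid (function_space X)) circle_group"
    using x by (auto simp: hom_def cis_mult distrib_left restrict_in_continuous_functions
        continuous_map_add continuous_functions_imp_continuous_map)
  ultimately show ?thesis
    by (simp add: characters_def)
qed

text \<open>A function \<open>g\<close> with \<open>\<bar>g x\<bar> > e\<close> for some \<open>x\<close> in \<open>K\<close> is separated from the ball by the character
  \<open>f \<mapsto> cis (c * f x)\<close>, where \<open>c\<close> is chosen such that \<open>c * e \<le> pi / 2 < c * \<bar>g x\<bar> \<le> pi\<close>.\<close>

lemma quasi_convex_uniform_ball:
  assumes K: "K \<subseteq> topspace X" and e: "e > 0"
  shows "quasi_convex (add_monoid (function_space X)) (compact_open_topology X)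
    {f \<in> continuous_functions X. \<forall>x\<in>K. \<bar>f x\<bar> \<le> e}" (is "quasi_convex ?G ?T ?A")
  unfolding quasi_convex_def
proof (intro conjI ballI)
  fix g assume "g \<in> carrier ?G - ?A"
  then obtain x where g: "g \<in> continuous_functions X" and x: "x \<in> K" "\<bar>g x\<bar> > e"
    by (auto simp: not_le)
  define c where "c = min (pi / \<bar>g x\<bar>) (pi / (2 * e))"
  have gx: "\<bar>g x\<bar> > 0" using x(2) e by linarith
  have c: "c > 0" "c \<le> pi / \<bar>g x\<bar>" "c \<le> pi / (2 * e)"
    using gx e by (auto simp: c_def)
  define \<phi> where "\<phi> = (\<lambda>f\<in>continuous_functions X. cis (c * f x))"
  have "\<phi> \<in> characters ?G ?T"
    unfolding \<phi>_def using x(1) K by (intro evaluation_character) auto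
  moreover have "\<phi> g \<notin> right_half_circle"
  proof -
    have "pi / 2 < c * \<bar>g x\<bar>"
    proof (cases "c = pi / \<bar>g x\<bar>")
      case True
      then show ?thesis using gx by simp
    next
      case False
      then have "c = pi / (2 * e)" by (auto simp: c_def min_def split: if_splits)
      then have "pi / 2 = c * e" using e by simp
      also have "\<dots> < c * \<bar>g x\<bar>" using x(2) c(1) by simp
      finally show ?thesis .
    qed
    moreover have "c * \<bar>g x\<bar> \<le> pi"
      using c(2) gx by (simp add: field_simps)
    ultimately have "cos (c * \<bar>g x\<bar>) < cos (pi / 2)"
      by (intro cos_monotone_0_pi) auto
    moreover have "cos (c * \<bar>g x\<bar>) = cos (c * g x)"
      by (cases "g x \<ge> 0") auto
    ultimately show ?thesis using g by (simp add: \<phi>_def right_half_circle_def)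
  qed
  moreover have "\<phi> ` ?A \<subseteq> right_half_circle"
  proof (intro image_subsetI)
    fix f assume f: "f \<in> ?A"
    then have "\<bar>f x\<bar> \<le> e" using x(1) by auto
    then have "\<bar>c * f x\<bar> \<le> pi / (2 * e) * e"
      unfolding abs_mult using c e by (intro mult_mono) auto
    then have "\<bar>c * f x\<bar> \<le> pi / 2" using e by simp
    then have "cos (c * f x) \<ge> 0" by (intro cos_ge_zero) (auto simp: abs_le_iff)
    then show "\<phi> f \<in> right_half_circle"
      using f by (simp add: \<phi>_def right_half_circle_def)
  qed
  ultimately show "\<exists>\<phi>\<in>characters ?G ?T. \<phi> g \<notin> right_half_circle \<and> \<phi> ` ?A \<subseteq> right_half_circle"
    by blast
qed auto

lemma maximally_almost_periodic_function_space:
  "maximally_almost_periodic (add_monoid (function_space X)) (compact_open_topology X)"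
  unfolding maximally_almost_periodic_def
proof (intro ballI impI)
  fix f g assume fg: "f \<in> carrier (add_monoid (function_space X))"
    "g \<in> carrier (add_monoid (function_space X))" "f \<noteq> g"
  then have C: "f \<in> continuous_functions X" "g \<in> continuous_functions X" by auto
  then obtain x where x: "x \<in> topspace X" "f x \<noteq> g x"
    using fg(3) extensionalityI[of f "topspace X" g] by (auto simp: continuous_functions_def)
  define c where "c = pi / (f x - g x)"
  have "c * f x = c * g x + pi" using x(2) by (simp add: c_def field_simps)
  then have "cis (c * f x) = - cis (c * g x)"
    by (simp flip: cis_mult)
  then have "cis (c * f x) \<noteq> cis (c * g x)" by auto
  then show "\<exists>\<phi>\<in>characters (add_monoid (function_space X)) (compact_open_topology X). \<phi> f \<noteq> \<phi> g"
    using C by (intro bexI[OF _ evaluation_character[OF x(1), of c]]) simp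
qed

lemma locally_quasi_convex_function_space:
  "locally_quasi_convex_group (add_monoid (function_space X)) (compact_open_topology X)"
  unfolding locally_quasi_convex_group_def
proof (intro conjI maximally_almost_periodic_function_space)
  let ?T = "compact_open_topology X" and ?z = "\<zero>\<^bsub>function_space X\<^esub>"
  show "abelian_topological_group (add_monoid (function_space X)) ?T"
    by (rule locally_convex_space.abelian_topological_group_add_monoid[OF locally_convex_function_space])
  have "neighbourhood_base_at ?z (quasi_convex (add_monoid (function_space X)) ?T) ?T"
    unfolding neighbourhood_base_at_def
  proof (intro allI impI, elim conjE)
    fix U assume U: "openin ?T U" "?z \<in> U"
    obtain K e where K: "compactin X K" "e > 0" "uniform_nbhd X K e ?z \<subseteq> U"
      using openin_compact_open_contains_uniform_nbhd[OF U] by blast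
    have zero: "?z \<in> continuous_functions X"
      using openin_compact_open_subset[OF U(1)] U(2) by blast
    have KX: "K \<subseteq> topspace X" using compactin_subset_topspace[OF K(1)] .
    have "e / 2 > 0" using K(2) by simp
    then obtain W where W: "openin ?T W" "?z \<in> W" "W \<subseteq> uniform_nbhd X K (e / 2) ?z"
      using uniform_nbhd_contains_openin[OF zero K(1)] by blast
    let ?A = "{f \<in> continuous_functions X. \<forall>x\<in>K. \<bar>f x\<bar> \<le> e / 2}"
    have "quasi_convex (add_monoid (function_space X)) ?T ?A"
      using KX \<open>e / 2 > 0\<close> by (rule quasi_convex_uniform_ball)
    moreover have "W \<subseteq> ?A"
    proof
      fix f assume "f \<in> W"
      then have "f \<in> uniform_nbhd X K (e / 2) ?z" using W(3) by blast
      then show "f \<in> ?A" using KX by (auto simp: uniform_nbhd_def subset_iff less_imp_le)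
    qed
    moreover have "?A \<subseteq> uniform_nbhd X K e ?z"
      using KX K(2) by (fastforce simp: uniform_nbhd_def)
    ultimately show "\<exists>V P. openin ?T V \<and> quasi_convex (add_monoid (function_space X)) ?T P \<and>
        ?z \<in> V \<and> V \<subseteq> P \<and> P \<subseteq> U"
      using W K(3) by (meson subset_trans)
  qed
  then show "neighbourhood_base_at \<one>\<^bsub>add_monoid (function_space X)\<^esub>
      (quasi_convex (add_monoid (function_space X)) ?T) ?T" by simp
qed

section \<open>Barrels of continuous functions\<close>

text \<open>A barrel of $C_k(X)$, described by total functions instead of functions that are extensional on
  the space, so that pointwise expressions need no restriction. Absorption is recorded in a weak
  form, which gives the usual one by balancedness.\<close>

locale function_barrel =
  fixes X :: "'a topology" and B :: "('a \<Rightarrow> real) set"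
  assumes continuous: "f \<in> B \<Longrightarrow> continuous_map X euclideanreal f"
    and convex: "\<lbrakk>f \<in> B; g \<in> B; 0 \<le> t; t \<le> 1\<rbrakk> \<Longrightarrow> (\<lambda>x. (1 - t) * f x + t * g x) \<in> B"
    and balanced: "\<lbrakk>f \<in> B; \<bar>t\<bar> \<le> 1\<rbrakk> \<Longrightarrow> (\<lambda>x. t * f x) \<in> B"
    and absorbing: "continuous_map X euclideanreal f \<Longrightarrow> \<exists>r>0. (\<lambda>x. r * f x) \<in> B"
    and closed: "\<lbrakk>continuous_map X euclideanreal f;
      \<And>K e. \<lbrakk>compactin X K; e > 0\<rbrakk> \<Longrightarrow> \<exists>g\<in>B. \<forall>x\<in>K. \<bar>g x - f x\<bar> < e\<rbrakk> \<Longrightarrow> f \<in> B"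
begin

lemma add_scaled:
  assumes "(\<lambda>x. f x / a) \<in> B" "(\<lambda>x. g x / b) \<in> B" "a > 0" "b > 0"
  shows "(\<lambda>x. (f x + g x) / (a + b)) \<in> B"
proof -
  have "(\<lambda>x. (1 - b / (a + b)) * (f x / a) + b / (a + b) * (g x / b)) \<in> B"
    using assms by (intro convex) auto
  moreover have "1 - b / (a + b) = a / (a + b)"
    using assms by (simp add: field_simps)
  ultimately show ?thesis
    using assms by (simp add: add_divide_distrib)
qed

lemma scaled_mono:
  assumes "(\<lambda>x. f x / a) \<in> B" "a > 0" "a \<le> b"
  shows "(\<lambda>x. f x / b) \<in> B"
proof -
  have "(\<lambda>x. a / b * (f x / a)) \<in> B"
    using assms by (intro balanced) auto
  then show ?thesis using assms by simp
qed

lemma uminus_mem: "f \<in> B \<Longrightarrow> (\<lambda>x. - f x) \<in> B"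
  using balanced[of f "-1"] by simp

text \<open>A nested-ball argument in the norm \<open>f \<mapsto> sup \<bar>f / h\<bar>\<close>: if no multiple of \<open>B\<close> contained the unit
  ball, each ball of this norm would contain a smaller one that misses a prescribed multiple of
  \<open>B\<close>, as that multiple is closed already in the coarser compact-open topology. The centres converge
  uniformly relative to \<open>h\<close>, and their limit is continuous and lies in no multiple of \<open>B\<close>,
  contrary to absorption.\<close>

lemma order_interval_absorbed_aux:
  assumes h: "continuous_map X euclideanreal h" and h1: "\<And>x. h x \<ge> 1"
  shows "\<exists>n>0. \<forall>f. continuous_map X euclideanreal f \<and> (\<forall>x\<in>topspace X. \<bar>f x\<bar> \<le> h x) \<longrightarrow>
    (\<lambda>x. f x / n) \<in> B"
proof (rule ccontr)
  assume "\<not> ?thesis"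
  then have bad: "\<exists>f. continuous_map X euclideanreal f \<and> (\<forall>x\<in>topspace X. \<bar>f x\<bar> \<le> h x) \<and>
      (\<lambda>x. f x / n) \<notin> B" if "n > 0" for n
    using that by blast
  \<comment> \<open>A pair consists of the centre and the radius of a ball; \<open>P k\<close> says that the ball misses \<open>k\<close> times \<open>B\<close> (for positive \<open>k\<close>),
     and \<open>Q k\<close> that the next ball is nested with at most half the radius.\<close>
  define P where "P k p \<longleftrightarrow> continuous_map X euclideanreal (fst p) \<and> snd p > (0::real) \<and>
      (k > 0 \<longrightarrow> (\<forall>u. continuous_map X euclideanreal u \<and>
        (\<forall>x\<in>topspace X. \<bar>u x - fst p x\<bar> \<le> snd p * h x) \<longrightarrow> (\<lambda>x. u x / real k) \<notin> B))"
    for k :: nat and p :: "('a \<Rightarrow> real) \<times> real"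
  define Q where "Q k p q \<longleftrightarrow> snd q \<le> snd p / 2 \<and>
      (\<forall>x\<in>topspace X. \<bar>fst q x - fst p x\<bar> \<le> snd p / 2 * h x)"
    for k :: nat and p q :: "('a \<Rightarrow> real) \<times> real"
  have "\<exists>s. \<forall>k. P k (s k) \<and> Q k (s k) (s (Suc k))"
  proof (rule dependent_nat_choice)
    show "\<exists>p. P 0 p"
      by (rule exI[of _ "(\<lambda>_. 0, 1)"]) (simp add: P_def)
    fix p k assume "P k p"
    then obtain g \<delta> where p: "p = (g, \<delta>)" and g: "continuous_map X euclideanreal g" and \<delta>: "\<delta> > 0"
      by (cases p) (auto simp: P_def)
    obtain r where r: "r > 0" "(\<lambda>x. r * g x) \<in> B"
      using absorbing[OF g] by blast
    define m where "m = 1 / r"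
    have m: "m > 0" "(\<lambda>x. g x / m) \<in> B"
      using r by (simp_all add: m_def mult.commute)
    \<comment> \<open>With \<open>g \<in> m B\<close>, the perturbed centre \<open>g + \<delta>/2 f\<close> lies in \<open>(k + 1) B\<close> only if \<open>\<delta>/2 f \<in> (k + 1 + m) B\<close>,
       that is, only if \<open>f \<in> c B\<close>.\<close>
    define c where "c = (real (Suc k) + m) * 2 / \<delta>"
    have c: "c > 0"
      unfolding c_def using m \<delta> by (intro divide_pos_pos mult_pos_pos add_pos_pos) auto
    obtain f where f: "continuous_map X euclideanreal f" "\<And>x. x \<in> topspace X \<Longrightarrow> \<bar>f x\<bar> \<le> h x"
        "(\<lambda>x. f x / c) \<notin> B"
      using bad[OF c] by blast
    define g' where "g' x = g x + \<delta> / 2 * f x" for x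
    have g': "continuous_map X euclideanreal g'"
      unfolding g'_def by (intro continuous_intros g f)
    have "(\<lambda>x. g' x / real (Suc k)) \<notin> B"
    proof
      assume "(\<lambda>x. g' x / real (Suc k)) \<in> B"
      moreover have "(\<lambda>x. - g x / m) \<in> B"
        using uminus_mem[OF m(2)] by simp
      ultimately have "(\<lambda>x. (g' x + - g x) / (real (Suc k) + m)) \<in> B"
        using m by (intro add_scaled) auto
      moreover have "(g' x + - g x) / (real (Suc k) + m) = f x / c" for x
        by (simp add: g'_def c_def mult_ac)
      ultimately show False using f(3) by simp
    qed
    then obtain K e where K: "compactin X K" "e > 0"
        "\<And>u. u \<in> B \<Longrightarrow> \<exists>x\<in>K. \<not> \<bar>u x - g' x / real (Suc k)\<bar> < e"
      using closed[of "\<lambda>x. g' x / real (Suc k)"] g'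
      by (metis (mono_tags, lifting) continuous_map_real_mult_right divide_inverse continuous_map_eq)
    have "compact (h ` K)"
      using image_compactin[OF K(1) h] by simp
    then obtain H where H: "H > 0" "\<And>x. x \<in> K \<Longrightarrow> \<bar>h x\<bar> \<le> H"
      using compact_imp_bounded[of "h ` K"] by (auto simp: bounded_pos)
    define \<delta>' where "\<delta>' = min (\<delta> / 2) (e / (2 * H))"
    have \<delta>': "\<delta>' > 0" "\<delta>' \<le> \<delta> / 2" "\<delta>' \<le> e / (2 * H)"
      using \<delta> K(2) H(1) by (auto simp: \<delta>'_def)
    have far: "(\<lambda>x. u x / real (Suc k)) \<notin> B"
      if u: "\<And>x. x \<in> topspace X \<Longrightarrow> \<bar>u x - g' x\<bar> \<le> \<delta>' * h x" for u
    proof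
      assume "(\<lambda>x. u x / real (Suc k)) \<in> B"
      then obtain x where x: "x \<in> K" "\<not> \<bar>u x / real (Suc k) - g' x / real (Suc k)\<bar> < e"
        using K(3) by blast
      have xX: "x \<in> topspace X"
        using x(1) compactin_subset_topspace[OF K(1)] by auto
      have "\<bar>u x / real (Suc k) - g' x / real (Suc k)\<bar> = \<bar>u x - g' x\<bar> / real (Suc k)"
        by (simp add: abs_divide flip: diff_divide_distrib)
      also have "\<dots> \<le> \<bar>u x - g' x\<bar>"
        by (simp add: divide_le_eq mult_le_cancel_left1)
      also have "\<dots> \<le> \<delta>' * h x" by (rule u[OF xX])
      also have "\<dots> \<le> e / (2 * H) * H"
        using \<delta>' H(2)[OF x(1)] h1[of x] K(2) H(1) by (intro mult_mono) auto
      also have "\<dots> < e" using K(2) H(1) by simp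
      finally show False using x(2) by simp
    qed
    have "P (Suc k) (g', \<delta>')"
      using g' \<delta>' far by (auto simp: P_def)
    moreover have "Q k p (g', \<delta>')"
      using \<delta>' f(2) \<delta> by (auto simp: Q_def p g'_def abs_mult)
    ultimately show "\<exists>q. P (Suc k) q \<and> Q k p q" by blast
  qed
  then obtain s where s: "\<And>k. P k (s k)" "\<And>k. Q k (s k) (s (Suc k))" by blast
  define g where "g k = fst (s k)" for k
  define \<delta> where "\<delta> k = snd (s k)" for k
  have g: "continuous_map X euclideanreal (g k)" and \<delta>: "\<delta> k > 0"
    and half: "\<delta> (Suc k) \<le> \<delta> k / 2"
    and step: "x \<in> topspace X \<Longrightarrow> \<bar>g (Suc k) x - g k x\<bar> \<le> \<delta> k / 2 * h x" for k x
    using s[of k] by (auto simp: P_def Q_def g_def \<delta>_def)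
  have far: "(\<lambda>x. u x / real k) \<notin> B" if "k > 0" "continuous_map X euclideanreal u"
      "\<And>x. x \<in> topspace X \<Longrightarrow> \<bar>u x - g k x\<bar> \<le> \<delta> k * h x" for u k
    using s(1)[of k] that by (auto simp: P_def g_def \<delta>_def)
  have \<delta>_le: "\<delta> k \<le> \<delta> 0 * (1/2) ^ k" for k
  proof (induction k)
    case (Suc k)
    then show ?case using half[of k] by simp
  qed simp
  have \<delta>_lim: "\<delta> \<longlonglongrightarrow> 0"
  proof (rule tendsto_sandwich[of "\<lambda>_. 0" \<delta> sequentially "\<lambda>k. \<delta> 0 * (1/2) ^ k"])
    show "(\<lambda>k. \<delta> 0 * (1/2) ^ k) \<longlonglongrightarrow> 0"
      by (intro tendsto_mult_right_zero LIMSEQ_realpow_zero) auto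
  qed (use \<delta> \<delta>_le in \<open>auto intro!: always_eventually less_imp_le\<close>)
  have tail: "\<bar>g (k + j) x - g k x\<bar> \<le> (\<delta> k - \<delta> (k + j)) * h x" if "x \<in> topspace X" for k j x
  proof (induction j)
    case (Suc j)
    have "\<bar>g (k + Suc j) x - g k x\<bar> \<le> \<delta> (k + j) / 2 * h x + (\<delta> k - \<delta> (k + j)) * h x"
      using Suc step[OF that, of "k + j"]
        abs_triangle_ineq[of "g (k + Suc j) x - g (k + j) x" "g (k + j) x - g k x"] by simp
    also have "\<dots> = (\<delta> k - \<delta> (k + j) / 2) * h x"
      by (simp add: algebra_simps)
    also have "\<dots> \<le> (\<delta> k - \<delta> (k + Suc j)) * h x"
      using half[of "k + j"] h1[of x] by (intro mult_right_mono) auto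
    finally show ?case .
  qed simp
  have tail': "\<bar>g (k + j) x - g k x\<bar> \<le> \<delta> k * h x" if "x \<in> topspace X" for k j x
  proof -
    have "(\<delta> k - \<delta> (k + j)) * h x \<le> \<delta> k * h x"
      using \<delta>[of "k + j"] h1[of x] by (intro mult_right_mono) auto
    then show ?thesis using tail[OF that, of k j] by simp
  qed
  have "convergent (\<lambda>k. g k x)" if x: "x \<in> topspace X" for x
  proof (rule Cauchy_convergent, rule metric_CauchyI)
    fix e :: real assume "e > 0"
    then have "\<forall>\<^sub>F k in sequentially. \<delta> k < e / 2 / h x"
      using h1[of x] by (intro order_tendstoD[OF \<delta>_lim]) auto
    then obtain k where "\<delta> k < e / 2 / h x"
      by (auto simp: eventually_sequentially)
    then have k: "\<delta> k * h x < e / 2"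
      using h1[of x] by (simp add: less_divide_eq)
    have "dist (g m x) (g n x) < e" if "m \<ge> k" "n \<ge> k" for m n
      using tail'[OF x, of k "m - k"] tail'[OF x, of k "n - k"] that k
      by (simp add: dist_real_def)
    then show "\<exists>M. \<forall>m\<ge>M. \<forall>n\<ge>M. dist (g m x) (g n x) < e" by blast
  qed
  then obtain l where l: "\<And>x. x \<in> topspace X \<Longrightarrow> (\<lambda>k. g k x) \<longlonglongrightarrow> l x"
    unfolding convergent_def by metis
  have near: "\<bar>l x - g k x\<bar> \<le> \<delta> k * h x" if "x \<in> topspace X" for x k
  proof (rule LIMSEQ_le_const2)
    show "(\<lambda>j. \<bar>g (k + j) x - g k x\<bar>) \<longlonglongrightarrow> \<bar>l x - g k x\<bar>"
      using LIMSEQ_ignore_initial_segment[OF l[OF that], of k]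
      by (intro tendsto_intros) (simp add: add.commute)
    show "\<exists>N. \<forall>j\<ge>N. \<bar>g (k + j) x - g k x\<bar> \<le> \<delta> k * h x"
      using tail'[OF that] by blast
  qed
  have hnz: "h x \<noteq> 0" for x using h1[of x] by auto
  have "continuous_map X Met_TC.mtopology (\<lambda>x. l x / h x)"
  proof (rule Met_TC.continuous_map_uniform_limit)
    show "\<forall>\<^sub>F k in sequentially. continuous_map X Met_TC.mtopology (\<lambda>x. g k x / h x)"
      using g h hnz by (intro always_eventually allI)
        (simp add: continuous_map_real_divide)
    fix e :: real assume "e > 0"
    then have "\<forall>\<^sub>F k in sequentially. \<delta> k < e"
      by (intro order_tendstoD[OF \<delta>_lim])
    then show "\<forall>\<^sub>F k in sequentially. \<forall>x\<in>topspace X. l x / h x \<in> UNIV \<and> dist (g k x / h x) (l x / h x) < e"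
    proof eventually_elim
      case (elim k)
      have "dist (g k x / h x) (l x / h x) < e" if "x \<in> topspace X" for x
      proof -
        have "dist (g k x / h x) (l x / h x) = \<bar>l x - g k x\<bar> / h x"
          using h1[of x] by (simp add: dist_real_def abs_minus_commute flip: diff_divide_distrib)
        also have "\<dots> \<le> \<delta> k"
          using near[OF that, of k] h1[of x] by (simp add: divide_le_eq)
        finally show ?thesis using elim by simp
      qed
      then show ?case by simp
    qed
  qed simp
  then have "continuous_map X euclideanreal (\<lambda>x. l x / h x)" by simp
  from continuous_map_real_mult[OF this h] have lc: "continuous_map X euclideanreal l"
    using hnz by simp
  obtain r where r: "r > 0" "(\<lambda>x. r * l x) \<in> B"
    using absorbing[OF lc] by blast
  obtain k where k: "1 / r < real k"
    using reals_Archimedean2 by blast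
  moreover have "0 < 1 / r" using r by simp
  ultimately have "k > 0" by (cases k) auto
  have "(\<lambda>x. l x / (1 / r)) \<in> B" using r by (simp add: mult.commute)
  then have "(\<lambda>x. l x / real k) \<in> B"
    by (rule scaled_mono) (use k r in auto)
  with far[OF \<open>k > 0\<close> lc near] show False by blast
qed

lemma order_interval_absorbed:
  assumes h: "continuous_map X euclideanreal h"
  obtains n where "n > 0" "\<And>f. \<lbrakk>continuous_map X euclideanreal f; \<And>x. x \<in> topspace X \<Longrightarrow> \<bar>f x\<bar> \<le> h x\<rbrakk>
    \<Longrightarrow> (\<lambda>x. f x / n) \<in> B"
proof -
  have "continuous_map X euclideanreal (\<lambda>x. \<bar>h x\<bar> + 1)"
    by (intro continuous_intros h)
  from order_interval_absorbed_aux[OF this] obtain n where n: "n > 0"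
      "\<And>f. continuous_map X euclideanreal f \<Longrightarrow> (\<forall>x\<in>topspace X. \<bar>f x\<bar> \<le> \<bar>h x\<bar> + 1) \<Longrightarrow> (\<lambda>x. f x / n) \<in> B"
    by auto
  show thesis
  proof (rule that[OF n(1)])
    fix f assume f: "continuous_map X euclideanreal f" "\<And>x. x \<in> topspace X \<Longrightarrow> \<bar>f x\<bar> \<le> h x"
    then have "\<forall>x\<in>topspace X. \<bar>f x\<bar> \<le> \<bar>h x\<bar> + 1"
      by fastforce
    then show "(\<lambda>x. f x / n) \<in> B" using n(2) f(1) by blast
  qed
qed

text \<open>Otherwise there are \<open>f n \<notin> B\<close> that vanish where \<open>\<phi> \<le> n\<close>. The sum \<open>h\<close> of the functions
  \<open>n * \<bar>f n\<bar>\<close> is locally finite, hence continuous, and its order interval contains all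
  \<open>n * f n\<close>. As \<open>B\<close> absorbs this interval, \<open>f n \<in> B\<close> for large \<open>n\<close>.\<close>

lemma supported_far_out_imp_mem:
  assumes \<phi>: "continuous_map X euclideanreal \<phi>"
  obtains M where "\<And>f. \<lbrakk>continuous_map X euclideanreal f;
    \<And>x. \<lbrakk>x \<in> topspace X; \<phi> x \<le> M\<rbrakk> \<Longrightarrow> f x = 0\<rbrakk> \<Longrightarrow> f \<in> B"
proof (rule ccontr)
  assume "\<not> thesis"
  then have "\<forall>n::nat. \<exists>f. continuous_map X euclideanreal f \<and>
      (\<forall>x\<in>topspace X. \<phi> x \<le> real n \<longrightarrow> f x = 0) \<and> f \<notin> B"
    using that by metis
  then obtain f where f: "\<And>n. continuous_map X euclideanreal (f n)"
      "\<And>n x. \<lbrakk>x \<in> topspace X; \<phi> x \<le> real n\<rbrakk> \<Longrightarrow> f n x = 0" "\<And>n. f n \<notin> B"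
    by metis
  define h where "h x = (\<Sum>n | real n < \<phi> x. real n * \<bar>f n x\<bar>)" for x
  have fin: "finite {n. real n < \<phi> x}" for x
  proof (rule finite_subset)
    show "{n. real n < \<phi> x} \<subseteq> {..nat \<lceil>\<phi> x\<rceil>}" by (auto simp: le_nat_iff) linarith
  qed simp
  define T where "T N = {x \<in> topspace X. \<phi> x < real N}" for N
  have h: "continuous_map X euclideanreal h"
  proof (rule pasting_lemma[where I = UNIV and T = T and f = "\<lambda>N x. \<Sum>n<N. real n * \<bar>f n x\<bar>"])
    show "openin X (T N)" for N
      using openin_continuous_map_preimage[OF \<phi>, of "{..<real N}"] by (simp add: T_def)
    show "continuous_map (subtopology X (T N)) euclideanreal (\<lambda>x. \<Sum>n<N. real n * \<bar>f n x\<bar>)" for N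
      by (intro continuous_map_from_subtopology continuous_map_sum continuous_map_real_mult_left
          continuous_map_real_abs f) auto
    have sum_eq: "(\<Sum>n<N. real n * \<bar>f n x\<bar>) = h x" if "x \<in> T N" for x N
      unfolding h_def using that f(2)[of x] fin
      by (intro sum.mono_neutral_right) (auto simp: T_def not_less)
    show "(\<Sum>n<i. real n * \<bar>f n x\<bar>) = (\<Sum>n<j. real n * \<bar>f n x\<bar>)"
      if "x \<in> topspace X \<inter> T i \<inter> T j" for i j x
      using sum_eq[of x i] sum_eq[of x j] that by simp
    show "\<exists>j. j \<in> UNIV \<and> x \<in> T j \<and> h x = (\<Sum>n<j. real n * \<bar>f n x\<bar>)" if "x \<in> topspace X" for x
    proof -
      obtain N where "\<phi> x < real N" using reals_Archimedean2 by blast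
      then have "x \<in> T N" using that by (simp add: T_def)
      then show ?thesis using sum_eq by (intro exI[of _ N]) simp
    qed
  qed
  obtain m where m: "m > 0" "\<And>f. \<lbrakk>continuous_map X euclideanreal f; \<And>x. x \<in> topspace X \<Longrightarrow> \<bar>f x\<bar> \<le> h x\<rbrakk>
    \<Longrightarrow> (\<lambda>x. f x / m) \<in> B"
    using order_interval_absorbed[OF h] by blast
  obtain n where n: "m < real n" using reals_Archimedean2 by blast
  have bound: "\<bar>real n * f n x\<bar> \<le> h x" if "x \<in> topspace X" for x
  proof (cases "real n < \<phi> x")
    case True
    have "real n * \<bar>f n x\<bar> \<le> h x"
      unfolding h_def using True fin
      by (intro member_le_sum[where f = "\<lambda>n. real n * \<bar>f n x\<bar>"]) auto
    then show ?thesis by (simp add: abs_mult)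
  next
    case False
    then show ?thesis using f(2)[OF that, of n] by (auto simp: h_def intro!: sum_nonneg)
  qed
  have "(\<lambda>x. real n * f n x / m) \<in> B"
    using bound by (intro m(2) continuous_map_real_mult_left f)
  then have "(\<lambda>x. real n * f n x / real n) \<in> B"
    by (rule scaled_mono) (use n m(1) in auto)
  moreover have "(\<lambda>x. real n * f n x / real n) = f n"
    using n m(1) by (intro ext) simp
  ultimately show False using f(3)[of n] by simp
qed

text \<open>The largest linear subspace contained in the barrel, that is, the null space of its gauge.\<close>

definition kernel :: "('a \<Rightarrow> real) set" where
  "kernel = {f. \<forall>t. (\<lambda>x. t * f x) \<in> B}"

lemma kernel_sum:
  assumes "\<And>i. i \<in> F \<Longrightarrow> f i \<in> kernel"
  shows "(\<lambda>x. \<Sum>i\<in>F. f i x) \<in> kernel"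
  using assms
proof (induction F rule: infinite_finite_induct)
  case (insert i F)
  have "(\<lambda>x. t * (\<Sum>i\<in>insert i F. f i x)) \<in> B" for t
  proof -
    have "(\<lambda>x. (2 * t) * f i x) \<in> B" "(\<lambda>x. (2 * t) * (\<Sum>i\<in>F. f i x)) \<in> B"
      using insert by (auto simp: kernel_def)
    from convex[OF this, of "1/2"] show ?thesis
      using insert.hyps by (simp add: algebra_simps)
  qed
  then show ?case by (simp add: kernel_def)
next
  case empty
  have "continuous_map X euclideanreal (\<lambda>_. 0)" by simp
  from absorbing[OF this] show ?case by (simp add: kernel_def)
next
  case (infinite F)
  have "continuous_map X euclideanreal (\<lambda>_. 0)" by simp
  from absorbing[OF this] show ?case using infinite by (simp add: kernel_def)
qed

text \<open>Infinitely many conditions \<open>\<phi> i \<le> M i\<close> are handled through closedness: on a compact set \<open>L\<close>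
  finitely many of the sets \<open>{M i < \<phi> i}\<close> cover the part of \<open>L\<close> outside \<open>W\<close>, and a partition of
  unity subordinate to them writes \<open>f\<close> on \<open>L\<close> as a sum of functions from the null space of the
  gauge.\<close>

lemma support_in_intersection:
  assumes \<phi>: "\<And>i. i \<in> I \<Longrightarrow> continuous_map X euclideanreal (\<phi> i)"
    and M: "\<And>i f. \<lbrakk>i \<in> I; continuous_map X euclideanreal f;
      \<And>x. \<lbrakk>x \<in> topspace X; \<phi> i x \<le> M i\<rbrakk> \<Longrightarrow> f x = 0\<rbrakk> \<Longrightarrow> f \<in> B"
    and f: "continuous_map X euclideanreal f"
    and W: "openin X W" "\<And>x. \<lbrakk>x \<in> topspace X; \<And>i. i \<in> I \<Longrightarrow> \<phi> i x \<le> M i\<rbrakk> \<Longrightarrow> x \<in> W"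
    and f0: "\<And>x. x \<in> W \<Longrightarrow> f x = 0"
  shows "f \<in> B"
proof (rule closed[OF f])
  fix L and e :: real assume L: "compactin X L" and e: "e > 0"
  have LX: "L \<subseteq> topspace X" using compactin_subset_topspace[OF L] .
  define C where "C = (topspace X - W) \<inter> L"
  have C: "compactin X C"
    unfolding C_def using L W(1) by (intro closed_Int_compactin) auto
  define U where "U i = {x \<in> topspace X. M i < \<phi> i x}" for i
  have "C \<subseteq> (\<Union>i\<in>I. U i)"
    using W(2) by (fastforce simp: C_def U_def not_le)
  moreover have "openin X (U i)" if "i \<in> I" for i
    using openin_continuous_map_preimage[OF \<phi>[OF that], of "{M i<..}"] by (simp add: U_def)
  ultimately have "\<exists>\<F>. finite \<F> \<and> \<F> \<subseteq> U ` I \<and> C \<subseteq> \<Union>\<F>"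
    using C unfolding compactin_def by (metis (no_types, lifting) imageE)
  then obtain F where F: "finite F" "F \<subseteq> I" "C \<subseteq> (\<Union>i\<in>F. U i)"
    by (metis finite_subset_image)
  define u where "u i x = max (\<phi> i x - M i) 0" for i x
  define s where "s x = (\<Sum>i\<in>F. u i x)" for x
  have u: "continuous_map X euclideanreal (u i)" if "i \<in> F" for i
    unfolding u_def using \<phi>[of i] F(2) that by (intro continuous_intros) auto
  have s: "continuous_map X euclideanreal s"
    unfolding s_def by (intro continuous_map_sum F(1) u)
  have spos: "s x > 0" if x: "x \<in> C" for x
  proof -
    obtain i where "i \<in> F" "x \<in> U i" using F(3) x by blast
    then show ?thesis
      unfolding s_def using F(1) by (intro sum_pos2[of F i]) (auto simp: u_def U_def)
  qed
  have "\<exists>d>0. \<forall>x\<in>C. d \<le> s x"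
  proof (cases "C = {}")
    case False
    have "compact (s ` C)" using image_compactin[OF C s] by simp
    then obtain y where "y \<in> s ` C" "\<And>z. z \<in> s ` C \<Longrightarrow> y \<le> z"
      using compact_attains_inf[of "s ` C"] False by auto
    then show ?thesis using spos by (intro exI[of _ y]) auto
  qed (auto intro: exI[of _ 1])
  then obtain d where d: "d > 0" "\<And>x. x \<in> C \<Longrightarrow> d \<le> s x" by blast
  \<comment> \<open>The quotients \<open>u i / max s d\<close> form the partition of unity; \<open>d\<close> keeps the denominator positive off \<open>C\<close>.\<close>
  define v where "v i x = f x * u i x / max (s x) d" for i x
  have v: "continuous_map X euclideanreal (v i)" if "i \<in> F" for i
    unfolding v_def using d(1) that
    by (intro continuous_map_real_divide continuous_map_real_mult continuous_map_real_max u s f) auto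
  have "(\<lambda>x. t * v i x) \<in> B" if "i \<in> F" for i t
    using F(2) that by (intro M[of i] continuous_map_real_mult_left v) (auto simp: v_def u_def)
  then have "(\<lambda>x. \<Sum>i\<in>F. v i x) \<in> kernel"
    by (intro kernel_sum) (auto simp: kernel_def)
  then have "(\<lambda>x. 1 * (\<Sum>i\<in>F. v i x)) \<in> B"
    unfolding kernel_def by blast
  moreover have "(\<Sum>i\<in>F. v i x) = f x" if "x \<in> L" for x
  proof -
    have "(\<Sum>i\<in>F. v i x) = f x * s x / max (s x) d"
      by (simp add: v_def s_def sum_distrib_left sum_divide_distrib)
    also have "\<dots> = f x"
    proof (cases "x \<in> W")
      case False
      then have "x \<in> C" using that LX by (auto simp: C_def)
      then have "d \<le> s x" using d(2) by blast
      then show ?thesis using d(1) by (simp add: max_absorb1)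
    qed (simp add: f0)
    finally show ?thesis .
  qed
  ultimately show "\<exists>g\<in>B. \<forall>x\<in>L. \<bar>g x - f x\<bar> < e"
    using e by (intro bexI[of _ "\<lambda>x. 1 * (\<Sum>i\<in>F. v i x)"]) auto
qed

text \<open>The coordinates of a closed embedding into a power of the real line, bounded by the constants of
  \<open>supported_far_out_imp_mem\<close>, define the compact set \<open>K\<close>. The radius \<open>d\<close> is such that twice the
  truncation of \<open>f\<close> at height \<open>d\<close> lies in \<open>B\<close>; twice the remainder lies in \<open>B\<close> because it vanishes
  where \<open>\<bar>f\<bar> < d\<close>.\<close>

lemma realcompact_imp_contains_neighbourhood:
  assumes "realcompact_space X"
  obtains K d where "compactin X K" "d > 0"
    "\<And>f. \<lbrakk>continuous_map X euclideanreal f; \<And>x. x \<in> K \<Longrightarrow> \<bar>f x\<bar> < d\<rbrakk> \<Longrightarrow> f \<in> B"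
proof -
  obtain I :: "('a \<Rightarrow> real) set" and e where emb: "embedding_map X (powertop_real I) e"
      and cl: "closedin (powertop_real I) (e ` topspace X)"
    using assms unfolding realcompact_space_def by blast
  have cont: "continuous_map X (powertop_real I) e"
    using emb homeomorphic_imp_continuous_map continuous_map_in_subtopology
    unfolding embedding_map_def by blast
  have proper: "proper_map X (powertop_real I) e"
  proof (rule closed_injective_imp_proper_map)
    show "closed_map X (powertop_real I) e"
      using emb cl by (rule embedding_imp_closed_map)
    show "inj_on e (topspace X)"
      using emb homeomorphic_imp_injective_map unfolding embedding_map_def by blast
  qed
  define \<phi> where "\<phi> i x = \<bar>e x i\<bar>" for i x
  have \<phi>: "continuous_map X euclideanreal (\<phi> i)" if "i \<in> I" for i
    using cont that unfolding \<phi>_def continuous_map_componentwise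
    by (intro continuous_map_real_abs) auto
  have "\<forall>i\<in>I. \<exists>M. \<forall>f. continuous_map X euclideanreal f \<and> (\<forall>x\<in>topspace X. \<phi> i x \<le> M \<longrightarrow> f x = 0)
      \<longrightarrow> f \<in> B"
    using supported_far_out_imp_mem[OF \<phi>] by (metis (lifting))
  then obtain M where M: "\<And>i f. \<lbrakk>i \<in> I; continuous_map X euclideanreal f;
      \<And>x. \<lbrakk>x \<in> topspace X; \<phi> i x \<le> M i\<rbrakk> \<Longrightarrow> f x = 0\<rbrakk> \<Longrightarrow> f \<in> B"
    by metis
  define K where "K = {x \<in> topspace X. e x \<in> (\<Pi>\<^sub>E i\<in>I. {- M i..M i})}"
  have K: "compactin X K"
    unfolding K_def by (rule compactin_proper_map_preimage[OF proper]) (simp add: compactin_PiE)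
  have inK: "x \<in> K" if "x \<in> topspace X" "\<And>i. i \<in> I \<Longrightarrow> \<phi> i x \<le> M i" for x
  proof -
    have "e x \<in> extensional I"
      using cont that(1) by (auto simp: continuous_map_componentwise)
    then show ?thesis
      using that by (auto simp: K_def PiE_def \<phi>_def abs_le_iff) (metis minus_le_iff)
  qed
  have "continuous_map X euclideanreal (\<lambda>_. 1)" by simp
  from order_interval_absorbed[OF this] obtain n where n: "n > 0"
      "\<And>f. \<lbrakk>continuous_map X euclideanreal f; \<And>x. x \<in> topspace X \<Longrightarrow> \<bar>f x\<bar> \<le> 1\<rbrakk> \<Longrightarrow> (\<lambda>x. f x / n) \<in> B"
    by metis
  define d where "d = 1 / (2 * n)"
  have d: "d > 0" using n(1) by (simp add: d_def)
  show thesis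
  proof (rule that[OF K d])
    fix f assume f: "continuous_map X euclideanreal f" and fK: "\<And>x. x \<in> K \<Longrightarrow> \<bar>f x\<bar> < d"
    define g where "g x = max (- d) (min d (f x))" for x
    have g: "continuous_map X euclideanreal g"
      unfolding g_def by (intro continuous_intros f)
    have "(\<lambda>x. (2 * n * g x) / n) \<in> B"
    proof (rule n(2))
      show "continuous_map X euclideanreal (\<lambda>x. 2 * n * g x)"
        by (intro continuous_map_real_mult_left g)
      show "\<bar>2 * n * g x\<bar> \<le> 1" for x
      proof -
        have "\<bar>g x\<bar> \<le> d" using d by (auto simp: g_def)
        then have "2 * n * \<bar>g x\<bar> \<le> 2 * n * d" using n(1) by (intro mult_left_mono) auto
        then show ?thesis using n(1) by (simp add: abs_mult d_def)
      qed
    qed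
    then have 1: "(\<lambda>x. 2 * g x) \<in> B" using n(1) by simp
    have 2: "(\<lambda>x. 2 * (f x - g x)) \<in> B"
    proof (rule support_in_intersection[of I \<phi> M _ "{x \<in> topspace X. f x \<in> {-d<..<d}}"])
      show "continuous_map X euclideanreal (\<lambda>x. 2 * (f x - g x))"
        by (intro continuous_map_real_mult_left continuous_map_diff f g)
      show "openin X {x \<in> topspace X. f x \<in> {-d<..<d}}"
        using openin_continuous_map_preimage[OF f, of "{-d<..<d}"] by simp
      show "x \<in> {x \<in> topspace X. f x \<in> {-d<..<d}}"
        if "x \<in> topspace X" "\<And>i. i \<in> I \<Longrightarrow> \<phi> i x \<le> M i" for x
        using fK[OF inK[OF that]] that(1) by (auto simp: abs_less_iff)
      show "2 * (f x - g x) = 0" if "x \<in> {x \<in> topspace X. f x \<in> {-d<..<d}}" for x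
        using that by (auto simp: g_def)
    qed (use \<phi> M in auto)
    have "f = (\<lambda>x. (1 - 1/2) * (2 * g x) + 1/2 * (2 * (f x - g x)))"
      by (intro ext) (simp add: field_simps)
    also have "\<dots> \<in> B" using convex[OF 1 2, of "1/2"] by simp
    finally show "f \<in> B" .
  qed
qed

end

section \<open>Realcompact spaces and the equivalence\<close>

lemma function_barrel_of_barrel:
  assumes "barrel (function_space X) (compact_open_topology X) B"
  shows "function_barrel X {f. continuous_map X euclideanreal f \<and> restrict f (topspace X) \<in> B}"
proof
  let ?r = "\<lambda>f. restrict f (topspace X)"
  let ?B = "{f. continuous_map X euclideanreal f \<and> ?r f \<in> B}"
  have clo: "closedin (compact_open_topology X) B" and con: "convex_in (function_space X) B"
    and bal: "balanced_in (function_space X) B" and abs: "absorbing_in (function_space X) B"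
    using assms by (auto simp: barrel_def)
  fix f :: "'a \<Rightarrow> real"
  show "continuous_map X euclideanreal f" if "f \<in> ?B" using that by simp
  show "(\<lambda>x. (1 - t) * f x + t * g x) \<in> ?B" if "f \<in> ?B" "g \<in> ?B" "0 \<le> t" "t \<le> 1" for g and t :: real
  proof -
    have "(1 - t) \<odot>\<^bsub>function_space X\<^esub> ?r f \<oplus>\<^bsub>function_space X\<^esub> t \<odot>\<^bsub>function_space X\<^esub> ?r g \<in> B"
      using con that by (auto simp: convex_in_def simp del: function_space_simps)
    then show ?thesis
      using that by (auto simp: continuous_map_add continuous_map_real_mult_left cong: restrict_cong)
  qed
  show "(\<lambda>x. t * f x) \<in> ?B" if "f \<in> ?B" "\<bar>t\<bar> \<le> 1" for t
  proof -
    have "t \<odot>\<^bsub>function_space X\<^esub> ?r f \<in> B"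
      using bal that by (auto simp: balanced_in_def simp del: function_space_simps)
    then show ?thesis
      using that by (auto simp: continuous_map_real_mult_left cong: restrict_cong)
  qed
  show "\<exists>r>0. (\<lambda>x. r * f x) \<in> ?B" if f: "continuous_map X euclideanreal f"
  proof -
    have "?r f \<in> carrier (function_space X)"
      using restrict_in_continuous_functions[OF f] by simp
    then obtain r where r: "r > 0" "\<And>t. \<bar>t\<bar> \<le> r \<Longrightarrow> t \<odot>\<^bsub>function_space X\<^esub> ?r f \<in> B"
      using abs unfolding absorbing_in_def by blast
    have "r \<odot>\<^bsub>function_space X\<^esub> ?r f \<in> B" using r by simp
    then show ?thesis
      using r(1) f by (intro exI[of _ r]) (auto simp: continuous_map_real_mult_left cong: restrict_cong)
  qed
  show "f \<in> ?B" if f: "continuous_map X euclideanreal f"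
    and approx: "\<And>K e. \<lbrakk>compactin X K; e > 0\<rbrakk> \<Longrightarrow> \<exists>g\<in>?B. \<forall>x\<in>K. \<bar>g x - f x\<bar> < e"
  proof (rule ccontr)
    assume "f \<notin> ?B"
    then have "?r f \<in> continuous_functions X - B"
      using f restrict_in_continuous_functions[OF f] by simp
    moreover have "openin (compact_open_topology X) (continuous_functions X - B)"
      using clo by (simp add: closedin_def topspace_compact_open_topology)
    ultimately obtain K e where K: "compactin X K" "e > 0"
        "uniform_nbhd X K e (?r f) \<subseteq> continuous_functions X - B"
      using openin_compact_open_contains_uniform_nbhd by blast
    obtain g where g: "g \<in> ?B" "\<And>x. x \<in> K \<Longrightarrow> \<bar>g x - f x\<bar> < e"
      using approx[OF K(1,2)] by blast
    have "?r g \<in> uniform_nbhd X K e (?r f)"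
      using g restrict_in_continuous_functions[of X g] compactin_subset_topspace[OF K(1)]
      by (auto simp: uniform_nbhd_def subset_iff)
    then show False using K(3) g(1) by auto
  qed
qed

theorem realcompact_imp_barrelled:
  assumes "realcompact_space X"
  shows "barrelled_space (function_space X) (compact_open_topology X)"
  unfolding barrelled_space_def
proof (intro conjI allI impI locally_convex_function_space)
  fix B assume B: "barrel (function_space X) (compact_open_topology X) B"
  interpret function_barrel X "{f. continuous_map X euclideanreal f \<and> restrict f (topspace X) \<in> B}"
    using B by (rule function_barrel_of_barrel)
  obtain K d where K: "compactin X K" "d > 0"
      "\<And>f. \<lbrakk>continuous_map X euclideanreal f; \<And>x. x \<in> K \<Longrightarrow> \<bar>f x\<bar> < d\<rbrakk> \<Longrightarrow> restrict f (topspace X) \<in> B"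
    using realcompact_imp_contains_neighbourhood[OF assms] by auto
  let ?z = "\<zero>\<^bsub>function_space X\<^esub>"
  have "?z \<in> continuous_functions X"
    by (simp add: restrict_in_continuous_functions)
  then obtain W where W: "openin (compact_open_topology X) W" "?z \<in> W" "W \<subseteq> uniform_nbhd X K d ?z"
    using K(1,2) by (rule uniform_nbhd_contains_openin)
  have "W \<subseteq> B"
  proof
    fix f assume "f \<in> W"
    then have f: "f \<in> continuous_functions X" "\<And>x. x \<in> K \<Longrightarrow> \<bar>f x\<bar> < d"
      using W(3) compactin_subset_topspace[OF K(1)] by (auto simp: uniform_nbhd_def subset_iff)
    then have "restrict f (topspace X) \<in> B"
      by (intro K(3)) (simp_all add: continuous_functions_imp_continuous_map)
    then show "f \<in> B"
      using f(1) by (simp add: continuous_functions_def extensional_restrict)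
  qed
  then show "\<exists>U. openin (compact_open_topology X) U \<and> ?z \<in> U \<and> U \<subseteq> B"
    using W by blast
qed

theorem theorem1p4:
  fixes X :: "'a topology"
  assumes "realcompact_space X"
  shows "barrelled_space (function_space X) (compact_open_topology X) \<longleftrightarrow>
         Mackey_group (add_monoid (function_space X)) (compact_open_topology X)"
  using realcompact_imp_barrelled[OF assms]
    barrelled_imp_Mackey_group[OF _ locally_quasi_convex_function_space] by blast

end
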